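(* Let $X$ and $Y$ be continuous real random variables with (unique) copula $C$. Then the following are equivalent: (1) $Y$ is stochastically increasing (respectively, decreasing) in $X$. (2) $C$ is stochastically increasing (respectively, decreasing) in the first component. (3) For every $v\in[0,1]$, the function $u\mapsto C(u,v)$ is concave (respectively, convex) on $[0,1]$. (4) The Markov operator $T_C$ is monotonicity-preserving (respectively, monotonicity-reversing), i.e. $T_C$ maps decreasing integrable functions onto decreasing (respectively, increasing) functions. (5) $x\mapsto \mathbb{E}(f(Y)\mid X=x)$ is decreasing (respectively, increasing) for every decreasing function $f$ such that the expectation exists. (The five "increasing" versions are equivalent to one another, and the five "respectively" versions are equivalent to one another.)
   Context: Monotonicity (increasing/decreasing) is understood in the non-strict sense. A random variable is continuous if its distribution function is continuous. A 2-copula is a bivariate distribution function on $[0,1]^2$ with uniform margins; the copula of $(X,Y)$ is the copula $C$ with $\mathbb{P}(X\le x,Y\le y)=C(F_X(x),F_Y(y))$. $Y$ is stochastically increasing in $X$ if for all $y$, $\mathbb{P}(Y\le y\mid X=x_2)\le \mathbb{P}(Y\le y\mid X=x_1)$ for almost all $x_1\le x_2$ in the support of $X$ (almost all with respect to the law of $X$); $Y$ is stochastically decreasing in $X$ if $\mathbb{P}(Y\le y\mid X=x)$ is instead increasing in $x$ in the same sense. Likewise, monotonicity of $x\mapsto\mathbb{E}(f(Y)\mid X=x)$ is understood up to null sets of the law of $X$. $C$ is stochastically increasing (decreasing) in the first component if, for every $v\in[0,1]$, the a.e. defined function $u\mapsto\partial_1 C(u,v)$ is decreasing (increasing) for almost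 all $u\in[0,1]$, i.e. agrees almost everywhere with a decreasing (increasing) function. A function $f\in L^1([0,1])$ is called decreasing (increasing) if it agrees almost everywhere with a decreasing (increasing) function $g:[0,1]\to\mathbb{R}$. The Markov operator $T_C:L^1([0,1])\to L^1([0,1])$ associated with $C$ is $T_Cf(u)=\partial_u\int_0^1\partial_vC(u,v)f(v)\,\mathrm{d}v$; it is positive, fixes $\mathbb{1}_{[0,1]}$, preserves the integral, and satisfies $T_C\mathbb{1}_{[0,v]}=\partial_1C(\cdot,v)$ a.e. *)

theory Defs
  imports "HOL-Probability.Probability"
begin

section \<open>Copulas\<close>

text \<open>Only the values of a copula on the unit square are meaningful. The uniform margins
  force the witnessing measure to be concentrated there.\<close>

definition is_copula :: "(real \<Rightarrow> real \<Rightarrow> real) \<Rightarrow> bool" where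
  "is_copula C \<longleftrightarrow>
     (\<exists>\<mu> :: (real \<times> real) measure. prob_space \<mu> \<and> sets \<mu> = sets borel \<and>
        distr \<mu> borel fst = uniform_measure lborel {0..1} \<and>
        distr \<mu> borel snd = uniform_measure lborel {0..1} \<and>
        (\<forall>u\<in>{0..1}. \<forall>v\<in>{0..1}. C u v = measure \<mu> ({..u} \<times> {..v})))"

definition is_copula_of ::
    "(real \<Rightarrow> real \<Rightarrow> real) \<Rightarrow> 'a measure \<Rightarrow> ('a \<Rightarrow> real) \<Rightarrow> ('a \<Rightarrow> real) \<Rightarrow> bool" where
  "is_copula_of C M X Y \<longleftrightarrow> is_copula C \<and>
     (\<forall>x y. measure M {\<omega> \<in> space M. X \<omega> \<le> x \<and> Y \<omega> \<le> y}
            = C (cdf (distr M borel X) x) (cdf (distr M borel Y) y))"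

text \<open>Partial derivatives of a copula exist almost everywhere on the unit interval; at the
  exceptional points (and possibly at the end points) \<^const>\<open>deriv\<close> is unspecified, which is
  harmless because these functions are used only up to null sets.\<close>

definition partial1 :: "(real \<Rightarrow> real \<Rightarrow> real) \<Rightarrow> real \<Rightarrow> real \<Rightarrow> real" where
  "partial1 C u v = deriv (\<lambda>s. C s v) u"

definition partial2 :: "(real \<Rightarrow> real \<Rightarrow> real) \<Rightarrow> real \<Rightarrow> real \<Rightarrow> real" where
  "partial2 C u v = deriv (\<lambda>t. C u t) v"

definition markov_operator :: "(real \<Rightarrow> real \<Rightarrow> real) \<Rightarrow> (real \<Rightarrow> real) \<Rightarrow> real \<Rightarrow> real" where
  "markov_operator C f u =
     deriv (\<lambda>s. integral\<^sup>L (lebesgue_on {0..1}) (\<lambda>v. partial2 C s v * f v)) u"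


section \<open>Monotonicity up to null sets\<close>

text \<open>The monotone representative is real-valued on the closed interval; in particular it is
  bounded.\<close>

definition ae_decreasing :: "(real \<Rightarrow> real) \<Rightarrow> bool" where
  "ae_decreasing f \<longleftrightarrow>
     (\<exists>g. antimono_on {0..1} g \<and> (AE u in lebesgue_on {0..1}. f u = g u))"

definition ae_increasing :: "(real \<Rightarrow> real) \<Rightarrow> bool" where
  "ae_increasing f \<longleftrightarrow>
     (\<exists>g. mono_on {0..1} g \<and> (AE u in lebesgue_on {0..1}. f u = g u))"

definition support :: "real measure \<Rightarrow> real set" where
  "support L = {x. \<forall>e>0. emeasure L (ball x e) > 0}"

text \<open>Monotonicity for almost all pairs of points of the support of a law. No globally monotone
  real-valued representative is required, since a monotone function on the support may be
  unbounded at an end point of the support.\<close>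

definition law_decreasing :: "real measure \<Rightarrow> (real \<Rightarrow> real) \<Rightarrow> bool" where
  "law_decreasing L h \<longleftrightarrow> (\<exists>N\<in>null_sets L. antimono_on (support L - N) h)"

definition law_increasing :: "real measure \<Rightarrow> (real \<Rightarrow> real) \<Rightarrow> bool" where
  "law_increasing L h \<longleftrightarrow> (\<exists>N\<in>null_sets L. mono_on (support L - N) h)"


section \<open>Conditioning on the value of a random variable\<close>

text \<open>A Borel function \<^term>\<open>h\<close> is a version of the function mapping \<^term>\<open>x\<close> to the conditional
  expectation of \<^term>\<open>Z\<close> given that \<^term>\<open>X\<close> equals \<^term>\<open>x\<close> if composing it with \<^term>\<open>X\<close>
  gives the conditional expectation of \<^term>\<open>Z\<close> given the sigma-algebra generated
  by \<^term>\<open>X\<close>.\<close>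

definition is_cond_exp_given ::
    "'a measure \<Rightarrow> ('a \<Rightarrow> real) \<Rightarrow> ('a \<Rightarrow> real) \<Rightarrow> (real \<Rightarrow> real) \<Rightarrow> bool" where
  "is_cond_exp_given M Z X h \<longleftrightarrow> h \<in> borel_measurable borel \<and>
     (AE \<omega> in M. h (X \<omega>) = real_cond_exp M (vimage_algebra (space M) X borel) Z \<omega>)"

lemma borel_measurable_vimage_algebra_factor:
  fixes X h :: "'a \<Rightarrow> real"
  assumes h: "h \<in> borel_measurable (vimage_algebra S X borel)"
  obtains g :: "real \<Rightarrow> real" where "g \<in> borel_measurable borel" "\<And>w. w \<in> S \<Longrightarrow> g (X w) = h w"
proof -
  let ?G = "vimage_algebra S X (borel :: real measure)"
  obtain s where s: "\<And>i::nat. simple_function ?G (s i)"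
    and lim: "\<And>w. w \<in> space ?G \<Longrightarrow> (\<lambda>i. s i w) \<longlonglongrightarrow> h w"
    using borel_measurable_implies_sequence_metric[OF h, of 0] by blast
  have "\<exists>B. B \<in> sets borel \<and> {w \<in> S. s i w = c} = X -` B \<inter> S" for i c
  proof -
    have "s i -` {c} \<inter> space ?G \<in> sets ?G" using s by (rule simple_functionD)
    moreover have "s i -` {c} \<inter> space ?G = {w \<in> S. s i w = c}" by auto
    ultimately have "{w \<in> S. s i w = c} \<in> sets ?G" by simp
    moreover have "sets ?G = {X -` A \<inter> S |A. A \<in> sets borel}"
      by (rule sets_vimage_algebra2) auto
    ultimately show ?thesis by auto
  qed
  then obtain B where B: "\<And>i c. B i c \<in> sets borel"
      "\<And>i c. {w \<in> S. s i w = c} = X -` B i c \<inter> S"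
    by metis
  define t where "t i x = (\<Sum>c\<in>s i ` S. c * indicator (B i c) x)" for i and x :: real
  have [measurable]: "t i \<in> borel_measurable borel" for i
    unfolding t_def using B(1) by measurable
  have t: "t i (X w) = s i w" if "w \<in> S" for i w
  proof -
    have fin: "finite (s i ` S)" using s[of i] by (auto simp: simple_function_def)
    have "indicator (B i c) (X w) = (if c = s i w then 1 else (0::real))" for c
      using B(2)[of i c] that by (auto simp: indicator_def)
    then have "t i (X w) = (\<Sum>c\<in>s i ` S. if c = s i w then s i w else 0)"
      unfolding t_def by (intro sum.cong) auto
    also have "\<dots> = s i w" using fin that by simp
    finally show ?thesis .
  qed
  show ?thesis
  proof
    show "(\<lambda>x. lim (\<lambda>i. t i x)) \<in> borel_measurable borel"
      by measurable
    show "lim (\<lambda>i. t i (X w)) = h w" if "w \<in> S" for w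
      using lim[of w] that by (simp add: t limI)
  qed
qed

lemma is_cond_exp_given_exists: "\<exists>h. is_cond_exp_given M Z X h"
proof -
  obtain g where "g \<in> borel_measurable borel"
    "\<And>w. w \<in> space M \<Longrightarrow> g (X w) = real_cond_exp M (vimage_algebra (space M) X borel) Z w"
    using borel_measurable_vimage_algebra_factor[OF borel_measurable_cond_exp] by metis
  then show ?thesis unfolding is_cond_exp_given_def by (intro exI[of _ g]) auto
qed

definition cond_exp_given ::
    "'a measure \<Rightarrow> ('a \<Rightarrow> real) \<Rightarrow> ('a \<Rightarrow> real) \<Rightarrow> real \<Rightarrow> real" where
  "cond_exp_given M Z X = (SOME h. is_cond_exp_given M Z X h)"

lemma is_cond_exp_given_cond_exp_given: "is_cond_exp_given M Z X (cond_exp_given M Z X)"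
  unfolding cond_exp_given_def using is_cond_exp_given_exists by (rule someI_ex)

lemma is_cond_exp_given_unique:
  assumes X: "X \<in> borel_measurable M"
    and g: "is_cond_exp_given M Z X g" and h: "is_cond_exp_given M Z X h"
  shows "AE x in distr M borel X. g x = h x"
proof -
  have [measurable]: "g \<in> borel_measurable borel" "h \<in> borel_measurable borel"
    using g h by (auto simp: is_cond_exp_given_def)
  have "AE w in M. g (X w) = h (X w)"
    using g h by (auto simp: is_cond_exp_given_def)
  then show ?thesis using X by (subst AE_distr_iff) auto
qed

definition cond_prob_le ::
    "'a measure \<Rightarrow> ('a \<Rightarrow> real) \<Rightarrow> real \<Rightarrow> ('a \<Rightarrow> real) \<Rightarrow> real \<Rightarrow> real" where
  "cond_prob_le M Y y X = cond_exp_given M (indicator {\<omega> \<in> space M. Y \<omega> \<le> y}) X"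


section \<open>Stochastic monotonicity\<close>

definition stoch_increasing :: "'a measure \<Rightarrow> ('a \<Rightarrow> real) \<Rightarrow> ('a \<Rightarrow> real) \<Rightarrow> bool" where
  "stoch_increasing M Y X \<longleftrightarrow> (\<forall>y. law_decreasing (distr M borel X) (cond_prob_le M Y y X))"

definition stoch_decreasing :: "'a measure \<Rightarrow> ('a \<Rightarrow> real) \<Rightarrow> ('a \<Rightarrow> real) \<Rightarrow> bool" where
  "stoch_decreasing M Y X \<longleftrightarrow> (\<forall>y. law_increasing (distr M borel X) (cond_prob_le M Y y X))"

definition copula_stoch_increasing1 :: "(real \<Rightarrow> real \<Rightarrow> real) \<Rightarrow> bool" where
  "copula_stoch_increasing1 C \<longleftrightarrow> (\<forall>v\<in>{0..1}. ae_decreasing (\<lambda>u. partial1 C u v))"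

definition copula_stoch_decreasing1 :: "(real \<Rightarrow> real \<Rightarrow> real) \<Rightarrow> bool" where
  "copula_stoch_decreasing1 C \<longleftrightarrow> (\<forall>v\<in>{0..1}. ae_increasing (\<lambda>u. partial1 C u v))"

definition markov_monotonicity_preserving :: "(real \<Rightarrow> real \<Rightarrow> real) \<Rightarrow> bool" where
  "markov_monotonicity_preserving C \<longleftrightarrow>
     (\<forall>f. integrable (lebesgue_on {0..1}) f \<and> ae_decreasing f \<longrightarrow>
        ae_decreasing (markov_operator C f))"

definition markov_monotonicity_reversing :: "(real \<Rightarrow> real \<Rightarrow> real) \<Rightarrow> bool" where
  "markov_monotonicity_reversing C \<longleftrightarrow>
     (\<forall>f. integrable (lebesgue_on {0..1}) f \<and> ae_decreasing f \<longrightarrow>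
        ae_increasing (markov_operator C f))"

end

theory Submission
  imports Defs
begin

text \<open>All five conditions say that certain primitives are concave (convex in the decreasing case).
For a random variable \<open>U\<close> that is uniform on the unit interval and an integrable \<open>Z\<close>, put
\<open>\<Psi>(u) = E[1{U \<le> u} Z]\<close>. If \<open>k\<close> is a version of \<open>E(Z | U = \<cdot>)\<close>, then \<open>\<Psi>\<close> is a primitive of \<open>k\<close>,
so \<open>\<Psi>\<close> is concave exactly when \<open>k\<close> is decreasing off a null set. This single fact turns each
condition into the concavity of a family of functions \<open>\<Psi>\<close>:

\<^item> With \<open>U = F(X)\<close>, where \<open>F\<close> is the continuous distribution function of \<open>X\<close>, the conditional
  expectation of \<open>Z\<close> given \<open>X\<close>, read along the quantile function of \<open>X\<close>, is such a density.
  Conditions (1) and (5) are the cases \<open>Z = 1{Y \<le> y}\<close> and \<open>Z = f(Y)\<close>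
  (\<open>law_monotone_cond_exp_iff\<close>), and the primitive for \<open>1{Y \<le> y}\<close> is \<open>u \<mapsto> C(u, G(y))\<close> with
  \<open>G\<close> the distribution function of \<open>Y\<close> (\<open>copula_of_eq_partial_mean\<close>).
\<^item> With \<open>U\<close> the first coordinate under the law on the unit square that defines \<open>C\<close>, the
  primitives for \<open>1{V \<le> v}\<close> and \<open>f(V)\<close>, \<open>V\<close> the second coordinate, are \<open>C(\<cdot>, v)\<close> and the
  function that the Markov operator differentiates (\<open>integral_partial2\<close>). Hence (2) and (4) are
  the cases \<open>Z = 1{V \<le> v}\<close> and \<open>Z = f(V)\<close>.

Condition (3) is the concavity of the family for indicators, so (1), (2) and (3) agree. For
(4) and (5) it remains to pass from indicators to monotone functions (\<open>concave_mean_antimono\<close>).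
The random variables \<open>Z\<close> with concave primitive form a cone, closed under dominated limits and
containing the constants of either sign. A decreasing function is, up to truncation, a uniform
limit of positive combinations of constants and indicators of its superlevel sets, and these
sets are lower half-lines; whether the end point belongs to the half-line does not matter, as
the law of \<open>Y\<close> has no atoms.

Conditions (2) and (4) speak of derivatives, so the a.e. differentiability of a primitive is
indispensable: Lebesgue's differentiation theorem on the line
(\<open>AE_primitive_has_derivative\<close>) is derived from Vitali's covering theorem. The decreasing
versions follow along with the increasing ones by a sign \<open>\<sigma>\<close> carried through the argument.\<close>

section \<open>Lebesgue's differentiation theorem on the unit interval\<close>

definition primitive :: "(real \<Rightarrow> real) \<Rightarrow> (real \<Rightarrow> real) \<Rightarrow> bool" where
  "primitive k H \<longleftrightarrow> k \<in> borel_measurable borel \<and> set_integrable lborel {0..1} k \<and>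
     (\<forall>a b. 0 \<le> a \<longrightarrow> a \<le> b \<longrightarrow> b \<le> 1 \<longrightarrow> H b - H a = (LBINT s:{a<..b}. k s))"

lemma primitive_measurable: "primitive k H \<Longrightarrow> k \<in> borel_measurable borel"
  by (simp add: primitive_def)

lemma primitive_diff:
  assumes "primitive k H" "0 \<le> a" "a \<le> b" "b \<le> 1"
  shows "H b - H a = (LBINT s:{a<..b}. k s)"
  using assms by (auto simp: primitive_def)

lemma primitive_integrable:
  assumes "primitive k H" "A \<in> sets borel" "A \<subseteq> {0..1}"
  shows "set_integrable lborel A k"
  using assms by (intro set_integrable_subset[of lborel "{0..1}" k A]) (auto simp: primitive_def)

lemma primitive_minus: "primitive k H \<Longrightarrow> primitive (\<lambda>x. - k x) (\<lambda>x. - H x)"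
  unfolding primitive_def set_lebesgue_integral_def set_integrable_def
  by (force simp: scaleR_minus_right minus_diff_commute)

text \<open>A steep secant, of slope at least \<open>r\<close>, forces the positive part of \<open>k - r\<close> to outweigh the
negative part. Stating this for nonnegative integrals lets it be summed over countably many
disjoint intervals without any integrability bookkeeping.\<close>

lemma primitive_excess_balance:
  assumes k: "primitive k H" and ab: "0 \<le> a" "a \<le> b" "b \<le> 1" and steep: "r * (b - a) \<le> H b - H a"
  shows "(\<integral>\<^sup>+x\<in>{a..b}. ennreal (r - k x) \<partial>lborel) \<le> (\<integral>\<^sup>+x\<in>{a..b}. ennreal (k x - r) \<partial>lborel)"
proof -
  have [measurable]: "k \<in> borel_measurable borel" using k by (rule primitive_measurable)
  have kint: "integrable lborel (\<lambda>x. indicator {a..b} x * k x)"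
    using primitive_integrable[OF k, of "{a..b}"] ab by (auto simp: set_integrable_def)
  have rint: "integrable lborel (\<lambda>x. indicator {a..b} x * r)"
    by (intro integrable_mult_left integrable_real_indicator) (auto simp: emeasure_lborel_Icc_eq)
  let ?g = "\<lambda>x. indicator {a..b} x * k x - indicator {a..b} x * r"
  have gint: "integrable lborel ?g" using kint rint by simp
  have "H b - H a = (LINT x|lborel. indicator {a..b} x * k x)"
    unfolding primitive_diff[OF k ab] set_lebesgue_integral_def
    by (rule integral_cong_AE, measurable, rule AE_mp[OF AE_lborel_singleton[of a]])
       (auto simp: indicator_def)
  then have "integral\<^sup>L lborel ?g = H b - H a - r * (b - a)"
    using kint rint ab by (simp add: algebra_simps)
  then have "0 \<le> enn2real (\<integral>\<^sup>+x. ennreal (?g x) \<partial>lborel) - enn2real (\<integral>\<^sup>+x. ennreal (- ?g x) \<partial>lborel)"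
    using steep real_lebesgue_integral_def[OF gint] by simp
  moreover have "(\<integral>\<^sup>+x. ennreal (?g x) \<partial>lborel) < \<infinity>" "(\<integral>\<^sup>+x. ennreal (- ?g x) \<partial>lborel) < \<infinity>"
    using gint by (auto simp: real_integrable_def less_top)
  ultimately have "(\<integral>\<^sup>+x. ennreal (- ?g x) \<partial>lborel) \<le> (\<integral>\<^sup>+x. ennreal (?g x) \<partial>lborel)"
    by (cases "\<integral>\<^sup>+x. ennreal (?g x) \<partial>lborel" rule: ennreal_cases; cases "\<integral>\<^sup>+x. ennreal (- ?g x) \<partial>lborel" rule: ennreal_cases) (simp_all add: ennreal_leI)
  moreover have "(\<integral>\<^sup>+x. ennreal (?g x) \<partial>lborel) = (\<integral>\<^sup>+x\<in>{a..b}. ennreal (k x - r) \<partial>lborel)"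
    by (intro nn_integral_cong) (auto simp: indicator_def)
  moreover have "(\<integral>\<^sup>+x. ennreal (- ?g x) \<partial>lborel) = (\<integral>\<^sup>+x\<in>{a..b}. ennreal (r - k x) \<partial>lborel)"
    by (intro nn_integral_cong) (auto simp: indicator_def)
  ultimately show ?thesis by simp
qed

text \<open>At these points the density stays below \<open>r\<close> by a margin, yet arbitrarily short secants have
slope at least \<open>r\<close>. Let \<open>B\<close> be the set where the density is at most \<open>r - \<delta>\<close>. The measure with
density \<open>(k - r)\<^sup>+\<close> vanishes on \<open>B\<close>, so by outer regularity some open set \<open>U\<close> around \<open>B\<close> has
measure less than \<open>\<delta> e\<close>. Vitali's theorem covers almost all of the exceptional points by
disjoint steep intervals inside \<open>U\<close>; on their union \<open>(k - r)\<^sup>-\<close> is at least \<open>\<delta>\<close> on \<open>B\<close> but has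
integral at most that of \<open>(k - r)\<^sup>+\<close>, which is less than \<open>\<delta> e\<close>. So the part of \<open>B\<close> inside the
union has measure at most \<open>e\<close>. Regularity is applied to \<open>B\<close> because the exceptional set is not
known to be measurable beforehand.\<close>

lemma negligible_steep_points:
  assumes k: "primitive k H" and \<delta>: "0 < \<delta>"
  shows "negligible {x \<in> {0<..<1}. k x \<le> r - \<delta> \<and>
     (\<forall>d>0. \<exists>a b. a \<le> x \<and> x \<le> b \<and> a < b \<and> b - a < d \<and> r * (b - a) \<le> H b - H a)}" (is "negligible ?A")
proof (rule negligible_outer_le[THEN iffD2, rule_format])
  fix e :: real assume e: "0 < e"
  have [measurable]: "k \<in> borel_measurable borel" using k by (rule primitive_measurable)
  define p where "p x = indicator {0..1} x * ennreal (k x - r)" for x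
  define q where "q x = indicator {0..1} x * ennreal (r - k x)" for x
  have [measurable]: "p \<in> borel_measurable borel" "q \<in> borel_measurable borel"
    unfolding p_def q_def by measurable
  define P where "P = density lborel p"
  define Q where "Q = density lborel q"
  define B where "B = {x \<in> {0<..<1}. k x \<le> r - \<delta>}"
  have [measurable]: "B \<in> sets borel" unfolding B_def by measurable
  have "integrable lborel (\<lambda>x. indicator {0..1} x * (k x - r))"
  proof -
    have "integrable lborel (\<lambda>x. indicator {0..1} x * k x)"
      using k by (auto simp: primitive_def set_integrable_def)
    moreover have "integrable lborel (\<lambda>x. indicator {0..1::real} x * r)"
      by (intro integrable_mult_left integrable_real_indicator) (auto simp: emeasure_lborel_Icc_eq)
    ultimately have "integrable lborel (\<lambda>x. indicator {0..1} x * k x - indicator {0..1} x * r)"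
      by (rule Bochner_Integration.integrable_diff)
    then show ?thesis by (simp add: algebra_simps)
  qed
  then have "(\<integral>\<^sup>+x. ennreal (indicator {0..1} x * (k x - r)) \<partial>lborel) < \<infinity>"
    by (auto simp: real_integrable_def less_top)
  moreover have "(\<integral>\<^sup>+x. ennreal (indicator {0..1} x * (k x - r)) \<partial>lborel) = emeasure P UNIV"
    by (auto simp: P_def emeasure_density p_def indicator_def intro!: nn_integral_cong)
  ultimately have finP: "emeasure P (space P) \<noteq> \<infinity>" by (auto simp: P_def)
  have "emeasure P B = 0"
  proof -
    have "emeasure P B = (\<integral>\<^sup>+x. p x * indicator B x \<partial>lborel)"
      unfolding P_def by (rule emeasure_density) auto
    also have "\<dots> = (\<integral>\<^sup>+x. 0 \<partial>(lborel :: real measure))"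
      by (rule nn_integral_cong)
        (use \<delta> in \<open>auto simp: p_def B_def indicator_def intro!: ennreal_neg\<close>)
    finally show ?thesis by simp
  qed
  moreover have "emeasure P B = (INF U\<in>{U. B \<subseteq> U \<and> open U}. emeasure P U)"
    by (rule outer_regular) (use finP in \<open>auto simp: P_def\<close>)
  ultimately have "(INF U\<in>{U. B \<subseteq> U \<and> open U}. emeasure P U) < ennreal (\<delta> * e)"
    using \<delta> e by simp
  then obtain V where V: "B \<subseteq> V" "open V" "emeasure P V < ennreal (\<delta> * e)"
    by (auto simp: INF_less_iff)
  define U where "U = V \<inter> {0<..<1}"
  have U: "B \<subseteq> U" "open U" "U \<subseteq> {0<..<1}" "U \<subseteq> V"
    using V by (auto simp: U_def B_def)
  define K where "K = {(a, b). a < b \<and> {a..b} \<subseteq> U \<and> r * (b - a) \<le> H b - H a}"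
  define c where "c i = (fst i + snd i) / 2" for i :: "real \<times> real"
  define \<rho> where "\<rho> i = (snd i - fst i) / 2" for i :: "real \<times> real"
  have cb: "cball (c i) (\<rho> i) = {fst i..snd i}" for i
    by (auto simp: cball_eq_atLeastAtMost c_def \<rho>_def field_simps)
  have fine: "\<exists>i. i \<in> K \<and> x \<in> cball (c i) (\<rho> i) \<and> \<rho> i < d" if x: "x \<in> ?A" and d: "0 < d" for x d
  proof -
    have "x \<in> U" using x U by (auto simp: B_def)
    then obtain \<epsilon> where \<epsilon>: "0 < \<epsilon>" "ball x \<epsilon> \<subseteq> U" using U(2) open_contains_ball by blast
    have "0 < min d \<epsilon>" using d \<epsilon> by simp
    then obtain a b where ab: "a \<le> x" "x \<le> b" "a < b" "b - a < min d \<epsilon>" "r * (b - a) \<le> H b - H a"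
      using x by blast
    have "{a..b} \<subseteq> ball x \<epsilon>" using ab by (auto simp: dist_real_def)
    then have "(a, b) \<in> K" using ab \<epsilon> by (auto simp: K_def)
    then show ?thesis using ab d unfolding cb by (intro exI[of _ "(a, b)"]) (auto simp: \<rho>_def)
  qed
  have "\<And>i. i \<in> K \<Longrightarrow> 0 < \<rho> i" by (auto simp: K_def \<rho>_def)
  from Vitali_covering_theorem_cballs[of K \<rho> ?A c, OF this fine]
  obtain D where D: "countable D" "D \<subseteq> K"
     "pairwise (\<lambda>i j. disjnt (cball (c i) (\<rho> i)) (cball (c j) (\<rho> j))) D"
     "negligible (?A - (\<Union>i\<in>D. cball (c i) (\<rho> i)))" by blast
  define I where "I = (\<Union>i\<in>D. {fst i..snd i})"
  have [measurable]: "I \<in> sets borel" unfolding I_def using D(1) by (intro sets.countable_UN') auto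
  have IU: "I \<subseteq> U" using D(2) by (fastforce simp: I_def K_def)
  have disj: "disjoint_family_on (\<lambda>i. {fst i..snd i}) D"
    using D(3) by (auto simp: disjoint_family_on_def pairwise_def disjnt_def cb)
  have one: "emeasure Q {fst i..snd i} \<le> emeasure P {fst i..snd i}" if "i \<in> D" for i
  proof -
    obtain a b where i: "i = (a, b)" by (cases i)
    have ab: "a < b" "{a..b} \<subseteq> {0<..<1}" "r * (b - a) \<le> H b - H a"
      using that D(2) i U(3) by (auto simp: K_def)
    have ab': "0 \<le> a" "a \<le> b" "b \<le> 1" using ab by (auto simp: subset_eq dest: bspec[of _ _ a] bspec[of _ _ b])
    have "emeasure Q {a..b} = (\<integral>\<^sup>+x\<in>{a..b}. ennreal (r - k x) \<partial>lborel)"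
      unfolding Q_def by (subst emeasure_density)
        (use ab in \<open>auto simp: q_def indicator_def intro!: nn_integral_cong\<close>)
    also have "\<dots> \<le> (\<integral>\<^sup>+x\<in>{a..b}. ennreal (k x - r) \<partial>lborel)"
      by (rule primitive_excess_balance[OF k ab' ab(3)])
    also have "\<dots> = emeasure P {a..b}"
      unfolding P_def by (subst emeasure_density)
        (use ab in \<open>auto simp: p_def indicator_def intro!: nn_integral_cong\<close>)
    finally show ?thesis by (simp add: i)
  qed
  have "ennreal \<delta> * emeasure lborel (I \<inter> B) = (\<integral>\<^sup>+x. ennreal \<delta> * indicator (I \<inter> B) x \<partial>lborel)"
    by (simp add: nn_integral_cmult_indicator)
  also have "\<dots> \<le> (\<integral>\<^sup>+x. q x * indicator I x \<partial>lborel)"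
    by (intro nn_integral_mono) (auto simp: q_def B_def indicator_def intro!: ennreal_leI)
  also have "\<dots> = emeasure Q I" unfolding Q_def by (subst emeasure_density) auto
  also have "\<dots> = (\<integral>\<^sup>+i. emeasure Q {fst i..snd i} \<partial>count_space D)"
    unfolding I_def by (intro emeasure_UN_countable D(1) disj) (auto simp: Q_def)
  also have "\<dots> \<le> (\<integral>\<^sup>+i. emeasure P {fst i..snd i} \<partial>count_space D)"
    by (intro nn_integral_mono) (auto intro: one)
  also have "\<dots> = emeasure P I"
    unfolding I_def by (intro emeasure_UN_countable[symmetric] D(1) disj) (auto simp: P_def)
  also have "\<dots> \<le> emeasure P V" using IU U V(2) by (intro emeasure_mono) (auto simp: P_def)
  also have "\<dots> < ennreal \<delta> * ennreal e" using V(3) \<delta> e by (simp add: ennreal_mult)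
  finally have "ennreal \<delta> * emeasure lborel (I \<inter> B) < ennreal \<delta> * ennreal e" .
  then have small: "emeasure lborel (I \<inter> B) \<le> ennreal e"
    by (meson linorder_not_le mult_left_mono nless_le zero_le)
  define R where "R = ?A - I"
  have "negligible R" using D(4) by (simp add: R_def I_def cb)
  then have null: "R \<in> null_sets lebesgue" by (simp add: negligible_iff_null_sets)
  have "I \<inter> B \<in> sets borel" by measurable
  then have IB: "I \<inter> B \<in> sets lebesgue" by (simp add: sets_completionI_sets)
  have em: "emeasure lebesgue (I \<inter> B \<union> R) = emeasure lborel (I \<inter> B)"
    using emeasure_Un_null_set[OF IB null] by simp
  show "\<exists>T. ?A \<subseteq> T \<and> T \<in> lmeasurable \<and> measure lebesgue T \<le> e"
  proof (intro exI[of _ "I \<inter> B \<union> R"] conjI)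
    show "?A \<subseteq> I \<inter> B \<union> R" by (auto simp: R_def B_def)
    have s: "I \<inter> B \<union> R \<in> sets lebesgue" using IB null by auto
    show "I \<inter> B \<union> R \<in> lmeasurable"
      using small s by (intro fmeasurableI) (auto simp: em le_less_trans[OF _ ennreal_less_top])
    show "measure lebesgue (I \<inter> B \<union> R) \<le> e"
      unfolding measure_def em using small e by (simp add: enn2real_leI)
  qed
qed

lemma AE_unit_iff:
  "(AE u in lebesgue_on {0..1::real}. P u) \<longleftrightarrow> (AE u in lborel. u \<in> {0<..<1} \<longrightarrow> P u)"
proof -
  have "(AE u in lebesgue_on {0..1}. P u) \<longleftrightarrow> (AE u in lborel. u \<in> {0..1} \<longrightarrow> P u)"
    by (subst AE_restrict_space_iff) (auto simp: AE_completion_iff)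
  also have "\<dots> \<longleftrightarrow> (AE u in lborel. u \<in> {0<..<1} \<longrightarrow> P u)"
  proof -
    have "AE u in lborel. u \<noteq> (0::real) \<and> u \<noteq> 1"
      using AE_lborel_singleton[of "0::real"] AE_lborel_singleton[of "1::real"] by eventually_elim auto
    then have "AE u in lborel. (u \<in> {0..1} \<longrightarrow> P u) \<longleftrightarrow> (u \<in> {0<..<1} \<longrightarrow> P u)"
      by eventually_elim auto
    then show ?thesis by (rule eventually_subst)
  qed
  finally show ?thesis .
qed

text \<open>If \<open>k x < r < k x + e\<close> with \<open>r\<close> rational, then \<open>x\<close> violates the bound only by being a steep
point for \<open>r\<close> and some margin \<open>1 / (n + 1)\<close>: a countable union of null sets.\<close>

lemma AE_upper_derivative_le:
  assumes k: "primitive k H"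
  shows "AE x in lborel. x \<in> {0<..<1} \<longrightarrow>
    (\<forall>e>0. \<exists>d>0. \<forall>a b. a \<le> x \<and> x \<le> b \<and> a < b \<and> b - a < d \<longrightarrow> H b - H a < (k x + e) * (b - a))"
proof -
  define A where "A r \<delta> = {x \<in> {0<..<1}. k x \<le> r - \<delta> \<and>
     (\<forall>d>0. \<exists>a b. a \<le> x \<and> x \<le> b \<and> a < b \<and> b - a < d \<and> r * (b - a) \<le> H b - H a)}" for r \<delta>
  define N where "N = (\<Union>r\<in>\<rat>. \<Union>n::nat. A r (1 / Suc n))"
  have "A r (1 / Suc n) \<in> null_sets lebesgue" for r and n :: nat
    unfolding A_def negligible_iff_null_sets[symmetric] by (rule negligible_steep_points[OF k]) simp
  then have "N \<in> null_sets lebesgue"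
    unfolding N_def by (intro null_sets_UN' countable_rat null_sets_UN)
  then have "AE x in lborel. x \<notin> N"
    by (metis AE_completion_iff AE_not_in)
  then show ?thesis
  proof eventually_elim
    case (elim x)
    show ?case
    proof (intro impI allI)
      fix e :: real assume x: "x \<in> {0<..<1}" and "0 < e"
      then have "k x < k x + e" by simp
      then obtain r where r: "r \<in> \<rat>" "k x < r" "r < k x + e" using Rats_dense_in_real by blast
      obtain n :: nat where n: "1 / Suc n < r - k x"
        using r(2) nat_approx_posE[of "r - k x"] by auto
      have "x \<notin> A r (1 / Suc n)" using elim r(1) by (auto simp: N_def)
      moreover have "k x \<le> r - 1 / Suc n" using n by simp
      ultimately have "\<not> (\<forall>d>0. \<exists>a b. a \<le> x \<and> x \<le> b \<and> a < b \<and> b - a < d \<and> r * (b - a) \<le> H b - H a)"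
        using x unfolding A_def by blast
      then obtain d where d: "d > 0" "\<And>a b. a \<le> x \<Longrightarrow> x \<le> b \<Longrightarrow> a < b \<Longrightarrow> b - a < d \<Longrightarrow> H b - H a < r * (b - a)"
        by (meson not_le)
      show "\<exists>d>0. \<forall>a b. a \<le> x \<and> x \<le> b \<and> a < b \<and> b - a < d \<longrightarrow> H b - H a < (k x + e) * (b - a)"
      proof (intro exI[of _ d] conjI allI impI d(1))
        fix a b assume ab: "a \<le> x \<and> x \<le> b \<and> a < b \<and> b - a < d"
        then have "H b - H a < r * (b - a)" using d(2) by blast
        also have "\<dots> \<le> (k x + e) * (b - a)" using r ab by (intro mult_right_mono) auto
        finally show "H b - H a < (k x + e) * (b - a)" .
      qed
    qed
  qed
qed

text \<open>Lebesgue's differentiation theorem: the lower bound on the slopes is the upper bound for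
\<open>- k\<close> and \<open>- H\<close>.\<close>

lemma AE_primitive_has_derivative:
  assumes k: "primitive k H"
  shows "AE x in lborel. x \<in> {0<..<1} \<longrightarrow> (H has_real_derivative k x) (at x)"
  using AE_upper_derivative_le[OF k] AE_upper_derivative_le[OF primitive_minus[OF k]]
proof eventually_elim
  case (elim x)
  show ?case
  proof
    assume x: "x \<in> {0<..<1}"
    have "((\<lambda>y. (H y - H x) / (y - x)) \<longlongrightarrow> k x) (at x)"
    proof (rule tendstoI)
      fix e :: real assume e: "0 < e"
      obtain d1 where d1: "d1 > 0" "\<And>a b. a \<le> x \<Longrightarrow> x \<le> b \<Longrightarrow> a < b \<Longrightarrow> b - a < d1 \<Longrightarrow> H b - H a < (k x + e) * (b - a)"
        using elim(1) x e by blast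
      obtain d2 where d2: "d2 > 0" "\<And>a b. a \<le> x \<Longrightarrow> x \<le> b \<Longrightarrow> a < b \<Longrightarrow> b - a < d2 \<Longrightarrow> - H b - - H a < (- k x + e) * (b - a)"
        using elim(2) x e by blast
      have main: "\<bar>(H y - H x) / (y - x) - k x\<bar> < e" if y: "y \<noteq> x" "\<bar>y - x\<bar> < min d1 d2" for y
      proof (cases "x < y")
        case True
        then show ?thesis using d1(2)[of x y] d2(2)[of x y] y by (auto simp: abs_less_iff field_simps)
      next
        case False
        then have "(H y - H x) / (y - x) = (H x - H y) / (x - y)"
          using y by (simp add: field_simps)
        then show ?thesis using False d1(2)[of y x] d2(2)[of y x] y by (auto simp: abs_less_iff field_simps)
      qed
      show "\<forall>\<^sub>F y in at x. dist ((H y - H x) / (y - x)) (k x) < e"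
        unfolding eventually_at by (intro exI[of _ "min d1 d2"]) (use main d1(1) d2(1) in \<open>auto simp: dist_real_def\<close>)
    qed
    then show "(H has_real_derivative k x) (at x)" by (simp add: has_field_derivative_iff)
  qed
qed

section \<open>Concave primitives\<close>

lemma primitive_ge:
  assumes k: "primitive k H" and ab: "0 \<le> a" "a \<le> b" "b \<le> 1"
    and c: "AE s in lborel. s \<in> {a<..<b} \<longrightarrow> c \<le> k s"
  shows "c * (b - a) \<le> H b - H a"
proof -
  have "c * (b - a) = (LINT s|lborel. indicator {a<..b} s * c)"
    using ab by simp
  also have "\<dots> \<le> (LINT s|lborel. indicator {a<..b} s * k s)"
  proof (rule integral_mono_AE)
    show "integrable lborel (\<lambda>s. indicator {a<..b} s * c)"
      by (intro integrable_mult_left integrable_real_indicator) (use ab in auto)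
    show "integrable lborel (\<lambda>s. indicator {a<..b} s * k s)"
      using primitive_integrable[OF k, of "{a<..b}"] ab
      by (simp add: set_integrable_def subset_eq)
    show "AE s in lborel. indicator {a<..b} s * c \<le> indicator {a<..b} s * k s"
      using c AE_lborel_singleton[of b] by eventually_elim (auto simp: indicator_def)
  qed
  also have "\<dots> = H b - H a"
    using primitive_diff[OF k ab] by (simp add: set_lebesgue_integral_def)
  finally show ?thesis .
qed

lemma primitive_le:
  assumes k: "primitive k H" and ab: "0 \<le> a" "a \<le> b" "b \<le> 1"
    and c: "AE s in lborel. s \<in> {a<..<b} \<longrightarrow> k s \<le> c"
  shows "H b - H a \<le> c * (b - a)"
  using primitive_ge[OF primitive_minus[OF k] ab, of "- c"] c by auto

lemma interval_minus_null_nonempty: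
  assumes "a < (b::real)" "N \<in> null_sets lborel"
  obtains s where "s \<in> {a<..<b}" "s \<notin> N"
proof -
  have "\<not> {a<..<b} \<subseteq> N"
  proof
    assume "{a<..<b} \<subseteq> N"
    then have "{a<..<b} \<in> null_sets lborel" using assms(2) by (auto intro: null_sets_subset)
    then show False using assms(1) by (auto simp: null_sets_def)
  qed
  then show ?thesis using that by blast
qed

text \<open>Forwards, compare the tangents at two points where \<open>H\<close> has derivative \<open>k\<close>. Backwards, the
infimum of \<open>k\<close> to the left of \<open>y\<close> bounds \<open>k\<close> from below on the left and from above on the
right, so it is the slope of a supporting line of \<open>H\<close> at \<open>y\<close>.\<close>

lemma concave_on_primitive_iff:
  assumes k: "primitive k H"
  shows "concave_on {0..1} H \<longleftrightarrow> (\<exists>N\<in>null_sets lborel. antimono_on ({0<..<1} - N) k)"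
proof
  assume conc: "concave_on {0..1} H"
  obtain N where N: "N \<in> null_sets lborel"
      "\<And>x. x \<in> {0<..<1} - N \<Longrightarrow> (H has_real_derivative k x) (at x)"
    using AE_primitive_has_derivative[OF k] by (auto elim!: AE_E3)
  have tangent: "H y - H x \<le> k x * (y - x)" if "x \<in> {0<..<1} - N" "y \<in> {0<..<1}" for x y
  proof -
    have "(H has_real_derivative k x) (at x within {0..1})"
      using N(2)[OF that(1)] by (rule has_field_derivative_at_within)
    then have "((\<lambda>x. - H x) has_real_derivative - k x) (at x within {0..1})"
      by (rule DERIV_minus)
    then have "- H y - - H x \<ge> - k x * (y - x)"
      using conc that by (intro convex_on_imp_above_tangent[where A="{0..1}"]) (auto simp: concave_on_def)
    then show ?thesis by simp
  qed
  have "k t \<le> k s" if "s \<in> {0<..<1} - N" "t \<in> {0<..<1} - N" "s \<le> t" for s t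
  proof (cases "s = t")
    case False
    have "k t * (t - s) \<le> k s * (t - s)"
      using tangent[of s t] tangent[of t s] that by (simp add: algebra_simps)
    then show ?thesis using False that by simp
  qed simp
  then show "\<exists>N\<in>null_sets lborel. antimono_on ({0<..<1} - N) k"
    using N(1) by (intro bexI[of _ N]) (auto simp: monotone_on_def)
next
  assume "\<exists>N\<in>null_sets lborel. antimono_on ({0<..<1} - N) k"
  then obtain N where N: "N \<in> null_sets lborel"
    and anti: "\<And>s t. s \<in> {0<..<1} - N \<Longrightarrow> t \<in> {0<..<1} - N \<Longrightarrow> s \<le> t \<Longrightarrow> k t \<le> k s"
    by (auto simp: monotone_on_def)
  have notN: "AE s in lborel. s \<notin> N" using N by (rule AE_not_in)
  have supp: "\<exists>c. (\<forall>x\<in>{0..1}. H x \<le> H y + c * (x - y))" if y: "y \<in> {0<..<1}" for y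
  proof -
    obtain s2 where s2: "s2 \<in> {y<..<1}" "s2 \<notin> N"
      by (rule interval_minus_null_nonempty[of y 1 N]) (use y N in simp_all)
    define c where "c = Inf (k ` ({0<..<y} - N))"
    have ge: "c \<le> k s" if "s \<in> {0<..<y} - N" for s
      unfolding c_def
    proof (rule cInf_lower)
      show "bdd_below (k ` ({0<..<y} - N))"
        by (rule bdd_belowI2[of _ "k s2"]) (rule anti, use s2 y in auto)
    qed (use that in auto)
    have le: "k s \<le> c" if "s \<in> {y<..<1} - N" for s
      unfolding c_def
    proof (rule cInf_greatest)
      obtain s1 where "s1 \<in> {0<..<y}" "s1 \<notin> N"
        by (rule interval_minus_null_nonempty[of 0 y N]) (use y N in simp_all)
      then show "k ` ({0<..<y} - N) \<noteq> {}" by blast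
      show "k s \<le> z" if "z \<in> k ` ({0<..<y} - N)" for z
        using that \<open>s \<in> {y<..<1} - N\<close> y by (auto intro!: anti)
    qed
    have "H x \<le> H y + c * (x - y)" if x: "x \<in> {0..1}" for x
    proof (cases "x \<le> y")
      case True
      have "c * (y - x) \<le> H y - H x"
        by (rule primitive_ge[OF k]) (use True x y notN ge in \<open>auto elim!: eventually_mono\<close>)
      then show ?thesis by (simp add: algebra_simps)
    next
      case False
      have "H x - H y \<le> c * (x - y)"
        by (rule primitive_le[OF k]) (use False x y notN le in \<open>auto elim!: eventually_mono\<close>)
      then show ?thesis by (simp add: algebra_simps)
    qed
    then show ?thesis by blast
  qed
  show "concave_on {0..1} H"
    unfolding concave_on_def
  proof (rule convex_on_linorderI)
    fix t x y :: real
    assume t: "0 < t" "t < 1" and xy: "x \<in> {0..1}" "y \<in> {0..1}" "x < y"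
    define z where "z = (1 - t) * x + t * y"
    have zx: "z - x = t * (y - x)" by (simp add: z_def algebra_simps)
    have zy: "y - z = (1 - t) * (y - x)" by (simp add: z_def algebra_simps)
    have "0 < z - x" "0 < y - z" unfolding zx zy using t xy by auto
    then have "x < z" "z < y" by auto
    then have "z \<in> {0<..<1}" using xy by auto
    then obtain c where c: "\<And>x. x \<in> {0..1} \<Longrightarrow> H x \<le> H z + c * (x - z)" using supp by blast
    have "(1 - t) * H x + t * H y \<le> (1 - t) * (H z + c * (x - z)) + t * (H z + c * (y - z))"
      using c xy t by (intro add_mono mult_left_mono) auto
    also have "\<dots> = H z + c * ((1 - t) * x + t * y - z)" by (simp add: algebra_simps)
    also have "\<dots> = H z" by (simp add: z_def)
    finally show "- H ((1 - t) *\<^sub>R x + t *\<^sub>R y) \<le> (1 - t) * - H x + t * - H y"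
      by (simp add: z_def)
  qed simp
qed

lemma concave_on_unit_cong:
  fixes f g :: "real \<Rightarrow> real"
  assumes eq: "\<And>u. u \<in> {0..1} \<Longrightarrow> f u = g u"
  shows "concave_on {0..1} f \<longleftrightarrow> concave_on {0..1} g"
  unfolding concave_on_iff using eq convexD[of "{0..1::real}"] by (metis convex_real_interval(5))

lemma convex_on_primitive_iff:
  assumes k: "primitive k H"
  shows "convex_on {0..1} H \<longleftrightarrow> (\<exists>N\<in>null_sets lborel. mono_on ({0<..<1} - N) k)"
  using concave_on_primitive_iff[OF primitive_minus[OF k]]
  by (simp add: concave_on_def monotone_on_def)

text \<open>The a.e. bound on \<open>k\<close> matters because a monotone representative has to be finite at the end
points of the closed unit interval.\<close>

lemma ae_decreasing_deriv_iff:
  assumes k: "primitive k H" and bdd: "AE s in lborel. s \<in> {0<..<1} \<longrightarrow> \<bar>k s\<bar> \<le> B"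
  shows "ae_decreasing (deriv H) \<longleftrightarrow> concave_on {0..1} H"
proof -
  have D: "AE s in lborel. s \<in> {0<..<1} \<longrightarrow> deriv H s = k s"
    using AE_primitive_has_derivative[OF k] by eventually_elim (auto intro: DERIV_imp_deriv)
  show ?thesis
  proof
    assume "ae_decreasing (deriv H)"
    then obtain g where g: "antimono_on {0..1} g" "AE s in lborel. s \<in> {0<..<1} \<longrightarrow> deriv H s = g s"
      by (auto simp: ae_decreasing_def AE_unit_iff)
    from g(2) D have "AE s in lborel. s \<in> {0<..<1} \<longrightarrow> k s = g s" by eventually_elim auto
    then obtain N where N: "N \<in> null_sets lborel" "\<And>s. s \<in> {0<..<1} - N \<Longrightarrow> k s = g s"
      by (auto elim!: AE_E3)
    then have "antimono_on ({0<..<1} - N) k" using g(1) by (auto simp: monotone_on_def)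
    then show "concave_on {0..1} H" using N(1) concave_on_primitive_iff[OF k] by blast
  next
    assume "concave_on {0..1} H"
    then obtain N1 where N1: "N1 \<in> null_sets lborel" "antimono_on ({0<..<1} - N1) k"
      using concave_on_primitive_iff[OF k] by blast
    obtain N2 where N2: "N2 \<in> null_sets lborel" "\<And>s. s \<in> {0<..<1} - N2 \<Longrightarrow> \<bar>k s\<bar> \<le> B"
      using bdd by (auto elim!: AE_E3)
    define S where "S = {0<..<1} - (N1 \<union> N2)"
    have anti: "\<And>s t. s \<in> S \<Longrightarrow> t \<in> S \<Longrightarrow> s \<le> t \<Longrightarrow> k t \<le> k s"
      using N1(2) by (auto simp: S_def monotone_on_def)
    have bS: "k s \<le> B" "- B \<le> k s" if "s \<in> S" for s
      using N2(2)[of s] that by (auto simp: S_def)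
    have B0: "- B \<le> B"
    proof -
      obtain s where "s \<in> {0<..<1}" "s \<notin> N2" 
        by (rule interval_minus_null_nonempty[of 0 1 N2]) (use N2 in simp_all)
      then show ?thesis using N2(2)[of s] by auto
    qed
    \<comment> \<open>Inserting the bound \<open>B\<close> keeps the set nonempty at points with no good point to their left.\<close>
    define G where "G x = insert B (k ` (S \<inter> {..x}))" for x
    have bb: "bdd_below (G x)" for x
      unfolding G_def by (rule bdd_belowI[of _ "- B"]) (use bS B0 in auto)
    define g where "g x = Inf (G x)" for x
    have "g y \<le> g x" if "x \<le> y" for x y
      unfolding g_def by (rule cInf_superset_mono[OF _ bb]) (use that in \<open>auto simp: G_def\<close>)
    then have "antimono_on {0..1} g" by (auto simp: monotone_on_def)
    moreover have gk: "g s = k s" if s: "s \<in> S" for s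
      unfolding g_def by (rule cInf_eq_minimum) (use s bS anti in \<open>auto simp: G_def\<close>)
    have "AE s in lborel. s \<in> {0<..<1} \<longrightarrow> deriv H s = g s"
      using D AE_not_in[OF N1(1)] AE_not_in[OF N2(1)] by eventually_elim (auto simp: gk S_def)
    ultimately show "ae_decreasing (deriv H)" by (auto simp: ae_decreasing_def AE_unit_iff)
  qed
qed

lemma ae_decreasing_cong:
  assumes "AE s in lborel. s \<in> {0<..<1} \<longrightarrow> f s = g s"
  shows "ae_decreasing f \<longleftrightarrow> ae_decreasing g" "ae_increasing f \<longleftrightarrow> ae_increasing g"
proof -
  have *: "(AE s in lborel. s \<in> {0<..<1} \<longrightarrow> f s = h s) \<longleftrightarrow> (AE s in lborel. s \<in> {0<..<1} \<longrightarrow> g s = h s)" for h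
    by (rule eventually_subst) (use assms in eventually_elim, auto)
  show "ae_decreasing f \<longleftrightarrow> ae_decreasing g" "ae_increasing f \<longleftrightarrow> ae_increasing g"
    by (simp_all only: ae_decreasing_def ae_increasing_def AE_unit_iff *)
qed

lemma ae_increasing_iff_ae_decreasing_minus: "ae_increasing f \<longleftrightarrow> ae_decreasing (\<lambda>x. - f x)"
proof
  assume "ae_increasing f"
  then obtain g where "mono_on {0..1} g" "AE u in lebesgue_on {0..1}. f u = g u"
    by (auto simp: ae_increasing_def)
  then show "ae_decreasing (\<lambda>x. - f x)"
    unfolding ae_decreasing_def by (intro exI[of _ "\<lambda>x. - g x"]) (auto simp: monotone_on_def)
next
  assume "ae_decreasing (\<lambda>x. - f x)"
  then obtain g where g: "antimono_on {0..1} g" "AE u in lebesgue_on {0..1}. - f u = g u"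
    by (auto simp: ae_decreasing_def)
  from g(2) have "AE u in lebesgue_on {0..1}. f u = - g u" by eventually_elim auto
  then show "ae_increasing f"
    unfolding ae_increasing_def using g(1) by (intro exI[of _ "\<lambda>x. - g x"]) (auto simp: monotone_on_def)
qed

lemma ae_increasing_deriv_iff:
  assumes k: "primitive k H" and bdd: "AE s in lborel. s \<in> {0<..<1} \<longrightarrow> \<bar>k s\<bar> \<le> B"
  shows "ae_increasing (deriv H) \<longleftrightarrow> convex_on {0..1} H"
proof -
  have "AE s in lborel. s \<in> {0<..<1} \<longrightarrow> - deriv H s = deriv (\<lambda>x. - H x) s"
    using AE_primitive_has_derivative[OF k]
    by eventually_elim (metis DERIV_imp_deriv DERIV_minus)
  then have "ae_increasing (deriv H) \<longleftrightarrow> ae_decreasing (deriv (\<lambda>x. - H x))"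
    unfolding ae_increasing_iff_ae_decreasing_minus by (rule ae_decreasing_cong)
  also have "\<dots> \<longleftrightarrow> concave_on {0..1} (\<lambda>x. - H x)"
    by (rule ae_decreasing_deriv_iff[OF primitive_minus[OF k], of B]) (use bdd in simp)
  finally show ?thesis by (simp add: concave_on_def)
qed

section \<open>Conditional means over an initial part of a uniform variable\<close>

definition partial_mean :: "'a measure \<Rightarrow> ('a \<Rightarrow> real) \<Rightarrow> ('a \<Rightarrow> real) \<Rightarrow> real \<Rightarrow> real" where
  "partial_mean M U Z u = (LINT \<omega>|M. indicator {..u} (U \<omega>) * Z \<omega>)"

lemma uniform_unit_eq_density:
  "uniform_measure lborel {0..1::real} = density lborel (\<lambda>s. ennreal (indicator {0..1} s))"
  unfolding uniform_measure_def by (intro density_cong) (auto simp: indicator_def)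

text \<open>The defining property of the conditional expectation, with test functions of \<open>X\<close> and with the
version \<open>h\<close> as a function on the line.\<close>

lemma is_cond_exp_given_intg:
  assumes "prob_space M" and [measurable]: "X \<in> borel_measurable M" "Z \<in> borel_measurable M"
    "\<phi> \<in> borel_measurable borel"
    and h: "is_cond_exp_given M Z X h" and int: "integrable M (\<lambda>\<omega>. \<phi> (X \<omega>) * Z \<omega>)"
  shows "integrable M (\<lambda>\<omega>. \<phi> (X \<omega>) * h (X \<omega>))"
    and "(LINT \<omega>|M. \<phi> (X \<omega>) * h (X \<omega>)) = (LINT \<omega>|M. \<phi> (X \<omega>) * Z \<omega>)"
proof -
  interpret prob_space M by fact
  let ?F = "vimage_algebra (space M) X (borel :: real measure)"
  have sub: "subalgebra M ?F"
    unfolding subalgebra_def by (auto simp: sets_vimage_algebra2)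
  interpret finite_measure_subalgebra M ?F by unfold_locales (rule sub)
  have [measurable]: "h \<in> borel_measurable borel" using h by (simp add: is_cond_exp_given_def)
  have "X \<in> measurable ?F borel" by (rule measurable_vimage_algebra1) auto
  then have \<phi>: "(\<lambda>\<omega>. \<phi> (X \<omega>)) \<in> borel_measurable ?F" by measurable
  have ae: "AE \<omega> in M. \<phi> (X \<omega>) * real_cond_exp M ?F Z \<omega> = \<phi> (X \<omega>) * h (X \<omega>)"
    using h by (auto simp: is_cond_exp_given_def)
  show "integrable M (\<lambda>\<omega>. \<phi> (X \<omega>) * h (X \<omega>))"
    using real_cond_exp_intg(1)[OF int \<phi>] ae
    by (subst integrable_cong_AE[symmetric]) auto
  show "(LINT \<omega>|M. \<phi> (X \<omega>) * h (X \<omega>)) = (LINT \<omega>|M. \<phi> (X \<omega>) * Z \<omega>)"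
    unfolding real_cond_exp_intg(2)[OF int \<phi> assms(3), symmetric]
    by (rule integral_cong_AE) (use ae in \<open>auto elim!: eventually_mono\<close>)
qed

lemma is_cond_exp_given_bounded:
  assumes "prob_space M" and [measurable]: "X \<in> borel_measurable M" "Z \<in> borel_measurable M"
    and h: "is_cond_exp_given M Z X h" and B: "AE \<omega> in M. \<bar>Z \<omega>\<bar> \<le> B"
  shows "AE \<omega> in M. \<bar>h (X \<omega>)\<bar> \<le> B"
proof -
  interpret prob_space M by fact
  let ?F = "vimage_algebra (space M) X (borel :: real measure)"
  have sub: "subalgebra M ?F"
    unfolding subalgebra_def by (auto simp: sets_vimage_algebra2)
  interpret finite_measure_subalgebra M ?F by unfold_locales (rule sub)
  have int: "integrable M Z" by (rule integrable_const_bound[of _ B]) (use B in auto)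
  have "AE \<omega> in M. real_cond_exp M ?F Z \<omega> \<le> B" "AE \<omega> in M. - B \<le> real_cond_exp M ?F Z \<omega>"
    by (rule real_cond_exp_le_c real_cond_exp_ge_c; use int B in \<open>auto elim!: eventually_mono\<close>)+
  moreover have "AE \<omega> in M. h (X \<omega>) = real_cond_exp M ?F Z \<omega>"
    using h by (simp add: is_cond_exp_given_def)
  ultimately show ?thesis by eventually_elim auto
qed

locale uniform_variable = prob_space M for M :: "'a measure" +
  fixes U :: "'a \<Rightarrow> real"
  assumes measurable_U [measurable]: "U \<in> borel_measurable M"
    and distr_U: "distr M borel U = uniform_measure lborel {0..1}"
begin

lemma integral_U:
  assumes [measurable]: "\<phi> \<in> borel_measurable borel"
  shows "(LINT \<omega>|M. \<phi> (U \<omega>)) = (LINT s|lborel. indicator {0..1} s * (\<phi> s :: real))"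
  using integral_distr[of U M borel \<phi>]
  by (simp add: distr_U uniform_unit_eq_density integral_real_density)

lemma integrable_U:
  assumes [measurable]: "\<phi> \<in> borel_measurable borel"
  shows "integrable M (\<lambda>\<omega>. \<phi> (U \<omega>) :: real) \<longleftrightarrow> set_integrable lborel {0..1} \<phi>"
  using integrable_distr_eq[of U M borel \<phi>]
  by (simp add: distr_U uniform_unit_eq_density integrable_real_density set_integrable_def)

lemma AE_U:
  assumes [measurable]: "Measurable.pred borel P"
  shows "(AE \<omega> in M. P (U \<omega>)) \<longleftrightarrow> (AE s in lborel. s \<in> {0..1} \<longrightarrow> P s)"
proof -
  have "(AE \<omega> in M. P (U \<omega>)) \<longleftrightarrow> (AE s in distr M borel U. P s)"
    by (subst AE_distr_iff) auto
  also have "\<dots> \<longleftrightarrow> (AE s in lborel. s \<in> {0..1} \<longrightarrow> P s)"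
    unfolding distr_U uniform_unit_eq_density
    by (subst AE_density) (auto simp: indicator_def)
  finally show ?thesis .
qed

lemma integrable_partial_mean:
  "integrable M Z \<Longrightarrow> integrable M (\<lambda>\<omega>. indicator A (U \<omega>) * Z \<omega> :: real)" if [measurable]: "A \<in> sets borel"
  by (rule Bochner_Integration.integrable_bound[of M Z]) (auto simp: indicator_def)

text \<open>The conditioning variable \<open>X\<close> may be finer than \<open>U = F X\<close>, as long as the conditional
expectation given \<open>X\<close> is almost surely a function of \<open>U\<close>. This generality serves a variable
\<open>X\<close> with distribution function \<open>F\<close>.\<close>

lemma primitive_partial_mean:
  assumes [measurable]: "X \<in> borel_measurable M" "F \<in> borel_measurable borel"
    and UX: "\<And>\<omega>. U \<omega> = F (X \<omega>)" and Z: "integrable M Z" and h: "is_cond_exp_given M Z X h"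
    and k[measurable]: "k \<in> borel_measurable borel" and hk: "AE \<omega> in M. h (X \<omega>) = k (U \<omega>)"
  shows "primitive k (partial_mean M U Z)"
proof -
  have [measurable]: "Z \<in> borel_measurable M" using Z by auto
  have [measurable]: "h \<in> borel_measurable borel" using h by (simp add: is_cond_exp_given_def)
  note intg = is_cond_exp_given_intg[OF prob_space_axioms _ _ _ h]
  have "integrable M (\<lambda>\<omega>. h (X \<omega>))"
    using intg(1)[of "\<lambda>_. 1"] Z by simp
  then have "integrable M (\<lambda>\<omega>. k (U \<omega>))"
    using hk by (subst integrable_cong_AE[symmetric]) auto
  then have kint: "set_integrable lborel {0..1} k" by (simp add: integrable_U)
  have "partial_mean M U Z b - partial_mean M U Z a = (LBINT s:{a<..b}. k s)"
    if ab: "0 \<le> a" "a \<le> b" "b \<le> 1" for a b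
  proof -
    have "partial_mean M U Z b - partial_mean M U Z a
        = (LINT \<omega>|M. indicator {..b} (U \<omega>) * Z \<omega> - indicator {..a} (U \<omega>) * Z \<omega>)"
      unfolding partial_mean_def using Z
      by (intro Bochner_Integration.integral_diff[symmetric] integrable_partial_mean) auto
    also have "\<dots> = (LINT \<omega>|M. (\<lambda>x. indicator {a<..b} (F x)) (X \<omega>) * Z \<omega>)"
      using ab by (intro Bochner_Integration.integral_cong) (auto simp: indicator_def UX)
    also have "\<dots> = (LINT \<omega>|M. (\<lambda>x. indicator {a<..b} (F x)) (X \<omega>) * h (X \<omega>))"
      using integrable_partial_mean[OF _ Z, of "{a<..b}"]
      by (intro intg(2)[symmetric]) (auto simp: UX)
    also have "\<dots> = (LINT \<omega>|M. indicator {a<..b} (U \<omega>) * k (U \<omega>))"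
      using hk by (intro integral_cong_AE) (auto simp: UX)
    also have "\<dots> = (LINT s|lborel. indicator {0..1} s * (indicator {a<..b} s * k s))"
      by (rule integral_U) measurable
    also have "\<dots> = (LBINT s:{a<..b}. k s)"
      unfolding set_lebesgue_integral_def
      using ab by (intro Bochner_Integration.integral_cong) (auto simp: indicator_def)
    finally show ?thesis .
  qed
  then show ?thesis using kint by (simp add: primitive_def)
qed

lemma primitive_partial_mean_cond_exp:
  assumes "integrable M Z" "is_cond_exp_given M Z U k"
  shows "primitive k (partial_mean M U Z)"
  by (rule primitive_partial_mean[of U "\<lambda>s. s" Z k])
    (use assms in \<open>auto simp: is_cond_exp_given_def\<close>)

lemma partial_mean_bounded_deriv_iff:
  assumes [measurable]: "Z \<in> borel_measurable M" and B: "AE \<omega> in M. \<bar>Z \<omega>\<bar> \<le> B"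
  shows "ae_decreasing (deriv (partial_mean M U Z)) \<longleftrightarrow> concave_on {0..1} (partial_mean M U Z)"
    and "ae_increasing (deriv (partial_mean M U Z)) \<longleftrightarrow> convex_on {0..1} (partial_mean M U Z)"
proof -
  have int: "integrable M Z" by (rule integrable_const_bound[of _ B]) (use B in auto)
  obtain k where k: "is_cond_exp_given M Z U k" using is_cond_exp_given_exists by blast
  then have [measurable]: "k \<in> borel_measurable borel" by (simp add: is_cond_exp_given_def)
  have "AE s in lborel. s \<in> {0..1} \<longrightarrow> \<bar>k s\<bar> \<le> B"
    using is_cond_exp_given_bounded[OF prob_space_axioms _ _ k B] by (subst AE_U[symmetric]) auto
  then have "AE s in lborel. s \<in> {0<..<1} \<longrightarrow> \<bar>k s\<bar> \<le> B" by eventually_elim auto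
  note * = primitive_partial_mean_cond_exp[OF int k] this
  show "ae_decreasing (deriv (partial_mean M U Z)) \<longleftrightarrow> concave_on {0..1} (partial_mean M U Z)"
    by (rule ae_decreasing_deriv_iff[OF *])
  show "ae_increasing (deriv (partial_mean M U Z)) \<longleftrightarrow> convex_on {0..1} (partial_mean M U Z)"
    by (rule ae_increasing_deriv_iff[OF *])
qed

text \<open>Constants have linear primitives, so they count as both concave and convex.\<close>

lemma partial_mean_const:
  assumes "u \<in> {0..1}" shows "partial_mean M U (\<lambda>_. c) u = c * u"
proof -
  have "partial_mean M U (\<lambda>_. c) u = (LINT s|lborel. indicator {0..1} s * (indicator {..u} s * c))"
    unfolding partial_mean_def by (rule integral_U) measurable
  also have "\<dots> = (LINT s|lborel. indicator {0..u} s * c)"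
    using assms by (intro Bochner_Integration.integral_cong) (auto simp: indicator_def)
  also have "\<dots> = c * u" using assms by simp
  finally show ?thesis .
qed

text \<open>The sign \<open>\<sigma>\<close> is 1 for concave and -1 for convex primitives.\<close>

definition concave_mean :: "real \<Rightarrow> ('a \<Rightarrow> real) \<Rightarrow> bool" where
  "concave_mean \<sigma> Z \<longleftrightarrow> integrable M Z \<and> concave_on {0..1} (\<lambda>u. \<sigma> * partial_mean M U Z u)"

lemma concave_mean_cong_AE:
  assumes "concave_mean \<sigma> Z" and [measurable]: "Z' \<in> borel_measurable M" and ae: "AE \<omega> in M. Z \<omega> = Z' \<omega>"
  shows "concave_mean \<sigma> Z'"
proof -
  have Z: "integrable M Z" using assms by (simp add: concave_mean_def)
  then have [measurable]: "Z \<in> borel_measurable M" by auto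
  have "partial_mean M U Z = partial_mean M U Z'"
    unfolding partial_mean_def by (intro ext integral_cong_AE) (use ae in auto)
  moreover have "integrable M Z'" using Z ae by (subst integrable_cong_AE[symmetric]) auto
  ultimately show ?thesis using assms(1) by (simp add: concave_mean_def)
qed

lemma concave_mean_const: "concave_mean \<sigma> (\<lambda>_. c)"
proof -
  have "concave_on {0..1} (\<lambda>u. \<sigma> * partial_mean M U (\<lambda>_. c) u)"
    unfolding concave_on_iff
  proof (intro conjI ballI allI impI)
    fix x y u v :: real assume *: "x \<in> {0..1}" "y \<in> {0..1}" "0 \<le> u" "0 \<le> v" "u + v = 1"
    then have "u *\<^sub>R x + v *\<^sub>R y \<in> {0..1}" using convexD[of "{0..1::real}"] by blast
    then show "u * (\<sigma> * partial_mean M U (\<lambda>_. c) x) + v * (\<sigma> * partial_mean M U (\<lambda>_. c) y)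
        \<le> \<sigma> * partial_mean M U (\<lambda>_. c) (u *\<^sub>R x + v *\<^sub>R y)"
      using * by (simp add: partial_mean_const algebra_simps)
  qed simp
  then show ?thesis by (simp add: concave_mean_def)
qed

lemma concave_mean_add:
  assumes "concave_mean \<sigma> Z" "concave_mean \<sigma> Z'"
  shows "concave_mean \<sigma> (\<lambda>\<omega>. Z \<omega> + Z' \<omega>)"
proof -
  have "partial_mean M U (\<lambda>\<omega>. Z \<omega> + Z' \<omega>) u = partial_mean M U Z u + partial_mean M U Z' u" for u
    unfolding partial_mean_def distrib_left using assms
    by (intro Bochner_Integration.integral_add integrable_partial_mean) (auto simp: concave_mean_def)
  then show ?thesis using assms
    by (auto simp: concave_mean_def distrib_left intro!: concave_on_add)
qed

lemma concave_mean_scale: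
  assumes "concave_mean \<sigma> Z" "0 \<le> c"
  shows "concave_mean \<sigma> (\<lambda>\<omega>. c * Z \<omega>)"
proof -
  have "partial_mean M U (\<lambda>\<omega>. c * Z \<omega>) u = c * partial_mean M U Z u" for u
    unfolding partial_mean_def by (subst integral_mult_right_zero[symmetric]) (simp add: mult.left_commute)
  moreover have "concave_on {0..1} (\<lambda>u. c * (\<sigma> * partial_mean M U Z u))"
    by (rule concave_on_cmul) (use assms in \<open>auto simp: concave_mean_def\<close>)
  ultimately show ?thesis using assms by (auto simp: concave_mean_def mult.left_commute)
qed

lemma concave_mean_sum:
  assumes "finite A" "\<And>i. i \<in> A \<Longrightarrow> concave_mean \<sigma> (Z i)"
  shows "concave_mean \<sigma> (\<lambda>\<omega>. \<Sum>i\<in>A. Z i \<omega>)"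
  using assms by (induction A) (auto intro: concave_mean_const concave_mean_add)

lemma concave_mean_limit:
  assumes Zn: "\<And>n::nat. concave_mean \<sigma> (Z n)" and lim: "\<And>\<omega>. (\<lambda>n. Z n \<omega>) \<longlonglongrightarrow> Z' \<omega>"
    and W: "integrable M W" "\<And>n \<omega>. \<bar>Z n \<omega>\<bar> \<le> W \<omega>"
  shows "concave_mean \<sigma> Z'"
proof -
  have [measurable]: "Z n \<in> borel_measurable M" for n using Zn[of n] by (auto simp: concave_mean_def)
  have [measurable]: "Z' \<in> borel_measurable M" by (rule borel_measurable_LIMSEQ_real[OF lim]) auto
  have [measurable]: "W \<in> borel_measurable M" using W by auto
  have int: "integrable M Z'"
    by (rule integrable_dominated_convergence[where s=Z and w=W]) (use W lim in auto)
  have conv: "(\<lambda>n. \<sigma> * partial_mean M U (Z n) u) \<longlonglongrightarrow> \<sigma> * partial_mean M U Z' u" for u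
    unfolding partial_mean_def
  proof (intro tendsto_mult_left integral_dominated_convergence[where w=W])
    show "AE \<omega> in M. (\<lambda>n. indicator {..u} (U \<omega>) * Z n \<omega>) \<longlonglongrightarrow> indicator {..u} (U \<omega>) * Z' \<omega>"
      using lim by (intro AE_I2 tendsto_mult_left) auto
    show "AE \<omega> in M. norm (indicator {..u} (U \<omega>) * Z n \<omega>) \<le> W \<omega>" for n
      using W(2)[of n] by (intro AE_I2) (auto simp: indicator_def intro: order_trans[OF abs_ge_zero])
  qed (use W in auto)
  have "concave_on {0..1} (\<lambda>u. \<sigma> * partial_mean M U Z' u)"
    unfolding concave_on_iff
  proof (intro conjI ballI allI impI)
    fix x y u v :: real assume *: "x \<in> {0..1}" "y \<in> {0..1}" "0 \<le> u" "0 \<le> v" "u + v = 1"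
    let ?P = "\<lambda>n u. \<sigma> * partial_mean M U (Z n) u"
    have "u * ?P n x + v * ?P n y \<le> ?P n (u *\<^sub>R x + v *\<^sub>R y)" for n
      using Zn[of n] * by (auto simp: concave_mean_def concave_on_iff)
    then show "u * (\<sigma> * partial_mean M U Z' x) + v * (\<sigma> * partial_mean M U Z' y)
        \<le> \<sigma> * partial_mean M U Z' (u *\<^sub>R x + v *\<^sub>R y)"
      by (intro LIMSEQ_le[OF tendsto_add[OF tendsto_mult_left[OF conv] tendsto_mult_left[OF conv]] conv]) auto
  qed simp
  then show ?thesis using int by (simp add: concave_mean_def)
qed

text \<open>A superlevel set of a decreasing function is empty, everything, or a lower half-line that is
open or closed; an open one differs from a closed one by a null event.\<close>

lemma concave_mean_superlevel:
  fixes f :: "real \<Rightarrow> real"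
  assumes [measurable]: "Y \<in> borel_measurable M" and noatom: "\<And>y. AE \<omega> in M. Y \<omega> \<noteq> y"
    and base: "\<And>y. concave_mean \<sigma> (\<lambda>\<omega>. indicator {..y} (Y \<omega>))"
    and f: "antimono f"
  shows "concave_mean \<sigma> (\<lambda>\<omega>. indicator {y. c \<le> f y} (Y \<omega>))"
proof -
  let ?D = "{y. c \<le> f y}"
  have down: "y \<in> ?D \<Longrightarrow> x \<le> y \<Longrightarrow> x \<in> ?D" for x y
    using antimonoD[OF f, of x y] by auto
  consider "?D = {}" | "?D = UNIV" | "?D \<noteq> {}" "?D \<noteq> UNIV" by blast
  then show ?thesis
  proof cases
    case 3
    obtain z where z: "z \<notin> ?D" using 3 by blast
    define a where "a = Sup ?D"
    have bdd: "bdd_above ?D" by (rule bdd_aboveI[of _ z]) (use down z in force)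
    have "y \<in> ?D \<longleftrightarrow> y \<le> a" if "y \<noteq> a" for y
    proof
      show "y \<le> a" if "y \<in> ?D" unfolding a_def using that bdd by (rule cSup_upper)
      assume "y \<le> a"
      then have "y < Sup ?D" using that by (simp add: a_def)
      then obtain x where "x \<in> ?D" "y < x" using less_cSup_iff[OF 3(1) bdd] by auto
      then show "y \<in> ?D" using down by auto
    qed
    then have ae: "AE \<omega> in M. indicator {..a} (Y \<omega>) = (indicator ?D (Y \<omega>) :: real)"
      using noatom[of a] by (auto simp: indicator_def elim!: eventually_mono)
    have "f \<in> borel_measurable borel"
      using borel_measurable_mono[of "\<lambda>x. - f x"] f by (auto simp: monotone_def)
    then have "(\<lambda>\<omega>. indicator ?D (Y \<omega>) :: real) \<in> borel_measurable M" by measurable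
    then show ?thesis using concave_mean_cong_AE[OF base _ ae] by simp
  qed (use concave_mean_const[of \<sigma> 0] concave_mean_const[of \<sigma> 1] in simp_all)
qed

text \<open>Rounding \<open>f\<close> down to multiples of \<open>1 / n\<close> gives the mean of the indicators of the superlevel
sets at the levels \<open>i / n\<close>.\<close>

lemma concave_mean_unit_range:
  fixes f :: "real \<Rightarrow> real"
  assumes "Y \<in> borel_measurable M" "\<And>y. AE \<omega> in M. Y \<omega> \<noteq> y"
    and "\<And>y. concave_mean \<sigma> (\<lambda>\<omega>. indicator {..y} (Y \<omega>))"
    and "antimono f" and f01: "\<And>y. 0 \<le> f y" "\<And>y. f y \<le> 1"
  shows "concave_mean \<sigma> (\<lambda>\<omega>. f (Y \<omega>))"
proof (rule concave_mean_limit)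
  let ?Z = "\<lambda>n \<omega>. (1 / real (Suc n)) * (\<Sum>i\<in>{1..Suc n}. indicator {y. real i / real (Suc n) \<le> f y} (Y \<omega>))"
  show "concave_mean \<sigma> (?Z n)" for n
    by (intro concave_mean_scale concave_mean_sum concave_mean_superlevel assms) auto
  have eq: "?Z n \<omega> = of_int \<lfloor>real (Suc n) * f (Y \<omega>)\<rfloor> / real (Suc n)" for n \<omega>
  proof -
    let ?t = "real (Suc n) * f (Y \<omega>)"
    have t: "0 \<le> ?t" "?t \<le> real (Suc n)" using f01[of "Y \<omega>"] by (auto simp: mult_left_le)
    have "(\<Sum>i\<in>{1..Suc n}. indicator {y. real i / real (Suc n) \<le> f y} (Y \<omega>)) = real (card {i\<in>{1..Suc n}. real i \<le> ?t})"
    proof -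
      have "(\<Sum>i\<in>{1..Suc n}. indicator {y. real i / real (Suc n) \<le> f y} (Y \<omega>))
          = (\<Sum>i\<in>{1..Suc n}. if real i \<le> ?t then 1 else (0::real))"
        by (intro sum.cong) (auto simp: indicator_def field_simps simp del: of_nat_Suc)
      also have "\<dots> = (\<Sum>i\<in>{i\<in>{1..Suc n}. real i \<le> ?t}. 1)"
        by (rule sum.inter_filter[symmetric]) simp
      finally show ?thesis by simp
    qed
    also have "{i\<in>{1..Suc n}. real i \<le> ?t} = {1..nat \<lfloor>?t\<rfloor>}"
    proof -
      have "real i \<le> ?t \<longleftrightarrow> i \<le> nat \<lfloor>?t\<rfloor>" if "1 \<le> i" for i
        using t that by (simp add: le_nat_iff le_floor_iff del: of_nat_Suc)
      moreover have "i \<le> Suc n" if "real i \<le> ?t" for i using order_trans[OF that t(2)] by simp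
      ultimately show ?thesis by auto
    qed
    finally show ?thesis using t by simp
  qed
  have close: "\<bar>?Z n \<omega> - f (Y \<omega>)\<bar> \<le> 1 / real (Suc n)" for n \<omega>
  proof -
    have "?Z n \<omega> - f (Y \<omega>) = (of_int \<lfloor>real (Suc n) * f (Y \<omega>)\<rfloor> - real (Suc n) * f (Y \<omega>)) / real (Suc n)"
      unfolding eq by (simp add: diff_divide_distrib del: of_nat_Suc)
    moreover have "\<bar>of_int \<lfloor>real (Suc n) * f (Y \<omega>)\<rfloor> - real (Suc n) * f (Y \<omega>)\<bar> \<le> 1" by linarith
    ultimately show ?thesis by (simp add: abs_divide divide_right_mono del: of_nat_Suc)
  qed
  show "(\<lambda>n. ?Z n \<omega>) \<longlonglongrightarrow> f (Y \<omega>)" for \<omega>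
  proof (rule Lim_null[THEN iffD2], rule Lim_null_comparison)
    show "\<forall>\<^sub>F n in sequentially. norm (?Z n \<omega> - f (Y \<omega>)) \<le> 1 / real (Suc n)"
      using close by (simp del: of_nat_Suc)
    show "(\<lambda>n. 1 / real (Suc n)) \<longlonglongrightarrow> 0" by (rule LIMSEQ_Suc[OF lim_1_over_n])
  qed
  show "\<bar>?Z n \<omega>\<bar> \<le> 2" for n \<omega>
  proof -
    have "1 / real (Suc n) \<le> 1" by simp
    then show ?thesis using close[of n \<omega>] f01[of "Y \<omega>"] unfolding abs_le_iff by linarith
  qed
qed simp

text \<open>The truncations of \<open>f\<close> at \<open>\<plusminus>n\<close> are dominated by \<open>f\<close> itself and are affine images, with
positive slope, of decreasing functions with values in the unit interval. The additive constant
is harmless because constants belong to the cone whatever their sign.\<close>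

lemma concave_mean_antimono:
  fixes f :: "real \<Rightarrow> real"
  assumes Y[measurable]: "Y \<in> borel_measurable M" and noatom: "\<And>y. AE \<omega> in M. Y \<omega> \<noteq> y"
    and base: "\<And>y. concave_mean \<sigma> (\<lambda>\<omega>. indicator {..y} (Y \<omega>))"
    and f: "antimono f" and int: "integrable M (\<lambda>\<omega>. f (Y \<omega>))"
  shows "concave_mean \<sigma> (\<lambda>\<omega>. f (Y \<omega>))"
proof (rule concave_mean_limit)
  let ?c = "\<lambda>n::nat. real (Suc n)"
  let ?g = "\<lambda>n y. (max (- ?c n) (min (?c n) (f y)) + ?c n) / (2 * ?c n)"
  have "concave_mean \<sigma> (\<lambda>\<omega>. ?g n (Y \<omega>))" for n
  proof (rule concave_mean_unit_range[OF Y noatom base])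
    show "antimono (?g n)"
      by (intro antimonoI divide_right_mono add_right_mono max.mono min.mono order_refl antimonoD[OF f]) auto
  qed (auto simp: field_simps)
  then have "concave_mean \<sigma> (\<lambda>\<omega>. - ?c n + 2 * ?c n * ?g n (Y \<omega>))" for n
    by (intro concave_mean_add concave_mean_const concave_mean_scale) auto
  then show "concave_mean \<sigma> (\<lambda>\<omega>. max (- ?c n) (min (?c n) (f (Y \<omega>))))" for n
    by (simp del: of_nat_Suc)
  show "(\<lambda>n. max (- ?c n) (min (?c n) (f (Y \<omega>)))) \<longlonglongrightarrow> f (Y \<omega>)" for \<omega>
  proof (rule tendsto_eventually)
    obtain N :: nat where "\<bar>f (Y \<omega>)\<bar> \<le> real N" using real_arch_simple by blast
    then show "\<forall>\<^sub>F n in sequentially. max (- ?c n) (min (?c n) (f (Y \<omega>))) = f (Y \<omega>)"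
      by (intro eventually_sequentiallyI[of N]) (auto simp: max_def min_def)
  qed
  show "integrable M (\<lambda>\<omega>. \<bar>f (Y \<omega>)\<bar>)" using int by simp
  show "\<bar>max (- ?c n) (min (?c n) (f (Y \<omega>)))\<bar> \<le> \<bar>f (Y \<omega>)\<bar>" for n \<omega> by auto
qed

end

section \<open>Conditioning on a variable with continuous distribution function\<close>

text \<open>Continuity makes the quantile function a right inverse of the distribution function; without it
only one inequality would hold. A quantile lies in the support since the distribution function
is strictly smaller to the left of it.\<close>

lemma quantile_function_exists:
  assumes "real_distribution L" and cts: "continuous_on UNIV (cdf L)"
  obtains q where "q \<in> borel_measurable borel" "mono_on {0<..<1} q"
    "\<And>s. s \<in> {0<..<1} \<Longrightarrow> cdf L (q s) = s" "\<And>s. s \<in> {0<..<1} \<Longrightarrow> q s \<in> support L"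
    "distr (restrict_space lborel {0<..<1}) borel q = L"
proof -
  interpret real_distribution L by fact
  interpret cdf_distribution L ..
  \<comment> \<open>The cut-off makes the pseudo-inverse Borel measurable on the whole line.\<close>
  define q where "q s = indicator {0<..<1} s * I s" for s
  have qI: "q s = I s" if "s \<in> {0<..<1}" for s using that by (simp add: q_def)
  have galois: "s \<le> cdf L x \<longleftrightarrow> q s \<le> x" if "s \<in> {0<..<1}" for s x
    using that pseudoinverse[of s x] by (simp add: qI)
  have below: "cdf L x < s" if "x < q s" "s \<in> {0<..<1}" for x s
    using galois[of s x] that by auto
  have cdf_q: "cdf L (q s) = s" if s: "s \<in> {0<..<1}" for s
  proof (rule antisym)
    show "s \<le> cdf L (q s)" using galois[OF s] by simp
    have "(cdf L \<longlongrightarrow> cdf L (q s)) (at_left (q s))"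
      using cts by (simp add: continuous_on_eq_continuous_at continuous_at filterlim_at_split)
    then show "cdf L (q s) \<le> s"
    proof (rule tendsto_upperbound)
      have "\<forall>\<^sub>F x in at_left (q s). x < q s" by (simp add: eventually_at_filter)
      then show "\<forall>\<^sub>F x in at_left (q s). cdf L x \<le> s"
        by eventually_elim (use below s in \<open>auto intro: less_imp_le\<close>)
    qed simp
  qed
  show ?thesis
  proof
    show "q \<in> borel_measurable borel"
      using measurable_CI by (subst (asm) borel_measurable_restrict_space_iff) (auto simp: q_def[abs_def])
    show "mono_on {0<..<1} q"
      using mono_I by (auto simp: monotone_on_def qI)
    show "cdf L (q s) = s" if "s \<in> {0<..<1}" for s by (rule cdf_q[OF that])
    show "q s \<in> support L" if s: "s \<in> {0<..<1}" for s
      unfolding support_def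
    proof (intro CollectI allI impI)
      fix e :: real assume e: "e > 0"
      have "0 < cdf L (q s) - cdf L (q s - e / 2)" using below[of "q s - e / 2" s] e s by (simp add: cdf_q)
      also have "\<dots> = measure L {q s - e / 2<..q s}" by (rule cdf_diff_eq) (use e in simp)
      also have "\<dots> \<le> measure L (ball (q s) e)"
        by (rule finite_measure_mono) (use e in \<open>auto simp: dist_real_def\<close>)
      finally show "0 < emeasure L (ball (q s) e)" by (simp add: emeasure_eq_measure)
    qed
    have "distr (restrict_space lborel {0<..<1}) borel q = distr (restrict_space lborel {0<..<1}) borel I"
      by (rule distr_cong) (auto simp: space_restrict_space qI)
    then show "distr (restrict_space lborel {0<..<1}) borel q = L" by (simp add: distr_I_eq_M)
  qed
qed

text \<open>The law is the image of the uniform law under the quantile function, and the distribution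
function undoes that map.\<close>

lemma distr_cdf_uniform:
  assumes "real_distribution L" "continuous_on UNIV (cdf L)"
  shows "distr L borel (cdf L) = uniform_measure lborel {0..1}"
proof -
  interpret real_distribution L by fact
  obtain q where q: "q \<in> borel_measurable borel" "\<And>s. s \<in> {0<..<1} \<Longrightarrow> cdf L (q s) = s"
    "distr (restrict_space lborel {0<..<1}) borel q = L"
    using quantile_function_exists[OF assms] by metis
  let ?\<Omega> = "restrict_space lborel {0<..<1::real}"
  have [measurable]: "cdf L \<in> borel_measurable borel"
    by (intro borel_measurable_mono monoI cdf_nondecreasing)
  have "distr L borel (cdf L) = distr (distr ?\<Omega> borel q) borel (cdf L)" by (simp add: q(3))
  also have "\<dots> = distr ?\<Omega> borel (cdf L \<circ> q)"
    using q(1) by (intro distr_distr) (auto intro: measurable_restrict_space1)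
  also have "\<dots> = distr ?\<Omega> borel (\<lambda>s. s)"
    by (rule distr_cong) (auto simp: space_restrict_space q(2))
  also have "\<dots> = uniform_measure lborel {0..1}"
  proof (rule measure_eqI)
    fix A :: "real set" assume "A \<in> sets (distr ?\<Omega> borel (\<lambda>s. s))"
    then have A[measurable]: "A \<in> sets borel" by simp
    have "emeasure (distr ?\<Omega> borel (\<lambda>s. s)) A = emeasure ?\<Omega> (A \<inter> {0<..<1})"
      by (subst emeasure_distr) (auto simp: space_restrict_space intro!: measurable_restrict_space1)
    also have "\<dots> = emeasure lborel (A \<inter> {0<..<1})"
      by (intro emeasure_restrict_space) auto
    also have "\<dots> = emeasure lborel ({0..1} \<inter> A)"
      by (rule emeasure_eq_AE)
        (use AE_lborel_singleton[of "0::real"] AE_lborel_singleton[of "1::real"] in \<open>eventually_elim, auto\<close>, measurable)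
    also have "\<dots> = emeasure (uniform_measure lborel {0..1}) A"
      by (subst emeasure_uniform_measure) (auto simp: divide_ennreal_def)
    finally show "emeasure (distr ?\<Omega> borel (\<lambda>s. s)) A = emeasure (uniform_measure lborel {0..1}) A" .
  qed simp
  finally show ?thesis .
qed

lemma AE_quantile_iff:
  fixes q :: "real \<Rightarrow> real"
  assumes "q \<in> borel_measurable borel" "distr (restrict_space lborel {0<..<1}) borel q = L"
    and [measurable]: "Measurable.pred borel P"
  shows "(AE x in L. P x) \<longleftrightarrow> (AE s in lborel. s \<in> {0<..<1} \<longrightarrow> P (q s))"
proof -
  have "(AE x in L. P x) \<longleftrightarrow> (AE s in restrict_space lborel {0<..<1}. P (q s))"
    unfolding assms(2)[symmetric]
    by (rule AE_distr_iff) (use assms(1) in \<open>auto intro: measurable_restrict_space1\<close>)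
  also have "\<dots> \<longleftrightarrow> (AE s in lborel. s \<in> {0<..<1} \<longrightarrow> P (q s))"
    by (rule AE_restrict_space_iff) auto
  finally show ?thesis .
qed

text \<open>Null sets are carried between the line and the unit interval by the quantile function and the
distribution function, which are monotone and inverse to each other up to null sets. Pairs of
points in order thus correspond to pairs of points in order.\<close>

lemma law_monotone_quantile_iff:
  assumes L: "real_distribution L"
    and q: "q \<in> borel_measurable borel" "mono_on {0<..<1} q"
      "\<And>s. s \<in> {0<..<1} \<Longrightarrow> cdf L (q s) = s" "\<And>s. s \<in> {0<..<1} \<Longrightarrow> q s \<in> support L"
      "distr (restrict_space lborel {0<..<1}) borel q = L"
  shows "law_decreasing L h \<longleftrightarrow> (\<exists>N\<in>null_sets lborel. antimono_on ({0<..<1} - N) (\<lambda>s. h (q s)))"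
    and "law_increasing L h \<longleftrightarrow> (\<exists>N\<in>null_sets lborel. mono_on ({0<..<1} - N) (\<lambda>s. h (q s)))"
proof -
  interpret real_distribution L by fact
  have pullback: "\<exists>N'\<in>null_sets lborel. \<forall>s\<in>{0<..<1} - N'. q s \<in> support L - N"
    if N: "N \<in> null_sets L" for N
  proof -
    have [measurable]: "N \<in> sets borel" using N by (auto simp: null_sets_def)
    have "AE x in L. x \<notin> N" using N by (rule AE_not_in)
    then have "AE s in lborel. s \<in> {0<..<1} \<longrightarrow> q s \<notin> N"
      by (subst (asm) AE_quantile_iff[OF q(1,5)]) auto
    then obtain N' where "N' \<in> null_sets lborel" "\<And>s. s \<in> {0<..<1} - N' \<Longrightarrow> q s \<notin> N"
      by (auto elim!: AE_E3)
    then show ?thesis using q(4) by (intro bexI[of _ N']) auto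
  qed
  have push: "\<exists>N'\<in>null_sets L. \<forall>x. x \<notin> N' \<longrightarrow> cdf L x \<in> {0<..<1} - N \<and> q (cdf L x) = x"
    if N: "N \<in> null_sets lborel" for N
  proof -
    have [measurable]: "N \<in> sets borel" using N by (auto simp: null_sets_def)
    have [measurable]: "cdf L \<in> borel_measurable borel"
      by (intro borel_measurable_mono monoI cdf_nondecreasing)
    note [measurable] = q(1)
    have "AE s in lborel. s \<notin> N" using N by (rule AE_not_in)
    then have "AE s in lborel. s \<in> {0<..<1} \<longrightarrow> cdf L (q s) \<in> {0<..<1} - N \<and> q (cdf L (q s)) = q s"
      by eventually_elim (auto simp: q(3))
    then have "AE x in L. cdf L x \<in> {0<..<1} - N \<and> q (cdf L x) = x"
      by (subst AE_quantile_iff[OF q(1,5)]) auto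
    then show ?thesis by (elim AE_E3) (metis DiffI UNIV_I space_eq_univ)
  qed
  \<comment> \<open>An arbitrary target relation \<open>r\<close> treats the increasing and the decreasing case at once.\<close>
  have "(\<exists>N\<in>null_sets L. monotone_on (support L - N) (\<le>) r h)
    \<longleftrightarrow> (\<exists>N\<in>null_sets lborel. monotone_on ({0<..<1} - N) (\<le>) r (\<lambda>s. h (q s)))"
    for r :: "real \<Rightarrow> real \<Rightarrow> bool"
  proof
    assume "\<exists>N\<in>null_sets L. monotone_on (support L - N) (\<le>) r h"
    then obtain N where N: "N \<in> null_sets L" and m: "monotone_on (support L - N) (\<le>) r h" by blast
    obtain N' where "N' \<in> null_sets lborel" "\<And>s. s \<in> {0<..<1} - N' \<Longrightarrow> q s \<in> support L - N"
      using pullback[OF N] by blast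
    then show "\<exists>N\<in>null_sets lborel. monotone_on ({0<..<1} - N) (\<le>) r (\<lambda>s. h (q s))"
      using m q(2) by (intro bexI[of _ N']) (auto simp: monotone_on_def)
  next
    assume "\<exists>N\<in>null_sets lborel. monotone_on ({0<..<1} - N) (\<le>) r (\<lambda>s. h (q s))"
    then obtain N where N: "N \<in> null_sets lborel"
      and m: "\<And>s t. s \<in> {0<..<1} - N \<Longrightarrow> t \<in> {0<..<1} - N \<Longrightarrow> s \<le> t \<Longrightarrow> r (h (q s)) (h (q t))"
      by (auto simp: monotone_on_def)
    obtain N' where N': "N' \<in> null_sets L"
      and x: "\<And>x. x \<notin> N' \<Longrightarrow> cdf L x \<in> {0<..<1} - N" "\<And>x. x \<notin> N' \<Longrightarrow> q (cdf L x) = x"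
      using push[OF N] by blast
    have "r (h x) (h y)" if "x \<notin> N'" "y \<notin> N'" "x \<le> y" for x y
      using m[OF x(1)[OF that(1)] x(1)[OF that(2)]] cdf_nondecreasing[OF that(3)] x(2) that by simp
    then show "\<exists>N\<in>null_sets L. monotone_on (support L - N) (\<le>) r h"
      using N' by (intro bexI[of _ N']) (auto simp: monotone_on_def)
  qed
  then show "law_decreasing L h \<longleftrightarrow> (\<exists>N\<in>null_sets lborel. antimono_on ({0<..<1} - N) (\<lambda>s. h (q s)))"
    and "law_increasing L h \<longleftrightarrow> (\<exists>N\<in>null_sets lborel. mono_on ({0<..<1} - N) (\<lambda>s. h (q s)))"
    by (simp_all add: law_decreasing_def law_increasing_def)
qed

context
  fixes M :: "'a measure" and X :: "'a \<Rightarrow> real"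
  assumes M: "prob_space M" and X[measurable]: "X \<in> borel_measurable M"
    and cont: "continuous_on UNIV (cdf (distr M borel X))"
begin

interpretation prob_space M by (rule M)

lemma uniform_variable_cdf: "uniform_variable M (\<lambda>\<omega>. cdf (distr M borel X) (X \<omega>))"
proof
  interpret L: real_distribution "distr M borel X" by (rule real_distribution_distr[OF X])
  have [measurable]: "cdf (distr M borel X) \<in> borel_measurable borel"
    by (intro borel_measurable_mono monoI L.cdf_nondecreasing)
  show "(\<lambda>\<omega>. cdf (distr M borel X) (X \<omega>)) \<in> borel_measurable M" by measurable
  show "distr M borel (\<lambda>\<omega>. cdf (distr M borel X) (X \<omega>)) = uniform_measure lborel {0..1}"
    using distr_cdf_uniform[OF real_distribution_distr[OF X] cont]
    by (subst (asm) distr_distr) (auto simp: o_def)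
qed

lemma AE_quantile_cdf:
  assumes "q \<in> borel_measurable borel" "\<And>s. s \<in> {0<..<1} \<Longrightarrow> cdf (distr M borel X) (q s) = s"
      "distr (restrict_space lborel {0<..<1}) borel q = distr M borel X"
  shows "AE \<omega> in M. X \<omega> = q (cdf (distr M borel X) (X \<omega>)) \<and> cdf (distr M borel X) (X \<omega>) \<in> {0<..<1}"
proof -
  interpret L: real_distribution "distr M borel X" by (rule real_distribution_distr[OF X])
  have [measurable]: "cdf (distr M borel X) \<in> borel_measurable borel"
    by (intro borel_measurable_mono monoI L.cdf_nondecreasing)
  note [measurable] = assms(1)
  have "AE x in distr M borel X. x = q (cdf (distr M borel X) x) \<and> cdf (distr M borel X) x \<in> {0<..<1}"
    by (subst AE_quantile_iff[OF assms(1,3)]) (auto simp: assms(2))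
  then show ?thesis by (subst (asm) AE_distr_iff) auto
qed

text \<open>Almost surely \<open>X\<close> is the quantile of \<open>F(X)\<close>. Hence the conditional expectation given \<open>X\<close>,
composed with the quantile function, is a density of the partial mean with respect to \<open>F(X)\<close>.\<close>

lemma law_monotone_cond_exp_iff:
  assumes Z: "integrable M Z"
  defines "P \<equiv> partial_mean M (\<lambda>\<omega>. cdf (distr M borel X) (X \<omega>)) Z"
  shows "law_decreasing (distr M borel X) (cond_exp_given M Z X) \<longleftrightarrow> concave_on {0..1} P"
    and "law_increasing (distr M borel X) (cond_exp_given M Z X) \<longleftrightarrow> convex_on {0..1} P"
proof -
  let ?L = "distr M borel X"
  interpret L: real_distribution ?L by (rule real_distribution_distr[OF X])
  interpret uniform_variable M "\<lambda>\<omega>. cdf ?L (X \<omega>)" by (rule uniform_variable_cdf)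
  have [measurable]: "cdf ?L \<in> borel_measurable borel"
    by (intro borel_measurable_mono monoI L.cdf_nondecreasing)
  obtain q where q: "q \<in> borel_measurable borel" "mono_on {0<..<1} q"
      "\<And>s. s \<in> {0<..<1} \<Longrightarrow> cdf ?L (q s) = s" "\<And>s. s \<in> {0<..<1} \<Longrightarrow> q s \<in> support ?L"
      "distr (restrict_space lborel {0<..<1}) borel q = ?L"
    using quantile_function_exists[OF real_distribution_distr[OF X] cont] by metis
  note [measurable] = q(1)
  let ?h = "cond_exp_given M Z X"
  have h: "is_cond_exp_given M Z X ?h" by (rule is_cond_exp_given_cond_exp_given)
  then have [measurable]: "?h \<in> borel_measurable borel" by (simp add: is_cond_exp_given_def)
  have "AE \<omega> in M. X \<omega> = q (cdf ?L (X \<omega>)) \<and> cdf ?L (X \<omega>) \<in> {0<..<1}"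
    by (rule AE_quantile_cdf) (use q in auto)
  then have "AE \<omega> in M. ?h (X \<omega>) = ?h (q (cdf ?L (X \<omega>)))"
    by eventually_elim simp
  then have prim: "primitive (\<lambda>s. ?h (q s)) P"
    unfolding P_def by (intro primitive_partial_mean[OF X _ _ Z h]) auto
  show "law_decreasing ?L ?h \<longleftrightarrow> concave_on {0..1} P"
    unfolding concave_on_primitive_iff[OF prim]
    by (rule law_monotone_quantile_iff) (use q real_distribution_distr[OF X] in auto)
  show "law_increasing ?L ?h \<longleftrightarrow> convex_on {0..1} P"
    unfolding convex_on_primitive_iff[OF prim]
    by (rule law_monotone_quantile_iff) (use q real_distribution_distr[OF X] in auto)
qed

end

lemma deriv_unit_cong:
  assumes "\<And>s. s \<in> {0..1} \<Longrightarrow> f s = g s" "u \<in> {0<..<1::real}"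
  shows "deriv f u = deriv g u"
proof (rule deriv_cong_ev)
  have "\<forall>\<^sub>F s in nhds u. s \<in> {0<..<1}" using assms(2) by (intro eventually_nhds_in_open) auto
  then show "\<forall>\<^sub>F s in nhds u. f s = g s" by eventually_elim (auto intro: assms(1))
qed simp

text \<open>The integrand may be merely a.e. equal to a Borel function; completeness of Lebesgue measure
supplies its measurability. This is how integrals of partial derivatives, which are unspecified
on a null set, are handled.\<close>

lemma integral_unit_cong:
  fixes f k :: "real \<Rightarrow> real"
  assumes [measurable]: "k \<in> borel_measurable borel"
    and ae: "AE v in lborel. v \<in> {0<..<1} \<longrightarrow> f v = k v"
  shows "integral\<^sup>L (lebesgue_on {0..1}) f = (LINT v|lborel. indicator {0..1} v * k v)"
proof -
  let ?K = "\<lambda>v. indicator {0..1} v * k v" and ?f = "\<lambda>v. indicator {0..1} v * f v"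
  have "AE v in lborel. ?K v = ?f v"
    using ae AE_lborel_singleton[of "0::real"] AE_lborel_singleton[of "1::real"]
    by eventually_elim (auto simp: indicator_def)
  then have ae': "AE v in lebesgue. ?K v = ?f v" by (simp add: AE_completion_iff)
  have K: "?K \<in> borel_measurable lborel" by measurable
  then have K': "?K \<in> borel_measurable lebesgue" by (rule measurable_completion)
  have "integral\<^sup>L (lebesgue_on {0..1}) f = integral\<^sup>L lebesgue ?f"
    by (subst integral_restrict_space) auto
  also have "\<dots> = integral\<^sup>L lebesgue ?K"
    by (rule integral_cong_AE[symmetric]) (use K' ae' borel_measurable_AE[OF K' ae'] in auto)
  also have "\<dots> = integral\<^sup>L lborel ?K" by (rule integral_completion[OF K])
  finally show ?thesis .
qed

section \<open>Copulas and the Markov operator\<close>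

text \<open>Keeping the law explicit makes its two coordinates available as uniform random variables, to
which the results on partial means apply in either order.\<close>

locale copula_law = prob_space \<mu> for \<mu> :: "(real \<times> real) measure" +
  fixes C :: "real \<Rightarrow> real \<Rightarrow> real"
  assumes sets_eq [measurable_cong]: "sets \<mu> = sets borel"
    and distr_fst: "distr \<mu> borel fst = uniform_measure lborel {0..1}"
    and distr_snd: "distr \<mu> borel snd = uniform_measure lborel {0..1}"
    and copula_eq: "\<And>u v. u \<in> {0..1} \<Longrightarrow> v \<in> {0..1} \<Longrightarrow> C u v = measure \<mu> ({..u} \<times> {..v})"
begin

sublocale first: uniform_variable \<mu> fst
proof
  show "fst \<in> borel_measurable \<mu>"
    unfolding measurable_cong_sets[OF sets_eq refl]
    by (intro borel_measurable_continuous_onI continuous_intros)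
qed (rule distr_fst)

sublocale second: uniform_variable \<mu> snd
proof
  show "snd \<in> borel_measurable \<mu>"
    unfolding measurable_cong_sets[OF sets_eq refl]
    by (intro borel_measurable_continuous_onI continuous_intros)
qed (rule distr_snd)

lemma space_eq [simp]: "space \<mu> = UNIV"
  using sets_eq_imp_space_eq[OF sets_eq] by simp

lemma copula_eq_partial_mean_fst:
  assumes "u \<in> {0..1}" "v \<in> {0..1}"
  shows "C u v = partial_mean \<mu> fst (\<lambda>p. indicator {..v} (snd p)) u"
proof -
  have [measurable]: "{..u} \<times> {..v} \<in> sets \<mu>"
    unfolding sets_eq by (intro borel_closed closed_Times) auto
  have "partial_mean \<mu> fst (\<lambda>p. indicator {..v} (snd p)) u = (LINT p|\<mu>. indicator ({..u} \<times> {..v}) p)"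
    unfolding partial_mean_def
    by (intro Bochner_Integration.integral_cong) (auto simp: indicator_def)
  then show ?thesis using assms by (simp add: copula_eq)
qed

lemma copula_eq_partial_mean_snd:
  assumes "u \<in> {0..1}" "v \<in> {0..1}"
  shows "C u v = partial_mean \<mu> snd (\<lambda>p. indicator {..u} (fst p)) v"
  using copula_eq_partial_mean_fst[OF assms] by (simp add: partial_mean_def mult.commute)

lemma copula_zero_left:
  assumes "v \<in> {0..1}" shows "C 0 v = 0"
proof -
  have "C 0 v \<le> measure \<mu> ({..0} \<times> UNIV)"
    using assms by (subst copula_eq) (auto intro!: finite_measure_mono borel_closed closed_Times simp: sets_eq)
  also have "\<dots> = measure (distr \<mu> borel fst) {..0}"
    by (subst measure_distr) (auto intro!: arg_cong[where f="measure \<mu>"])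
  also have "\<dots> = 0" by (simp add: distr_fst measure_uniform_measure)
  finally show ?thesis
    using assms by (simp add: copula_eq order_antisym)
qed

lemma copula_one_left:
  assumes "v \<in> {0..1}" shows "C 1 v = v"
proof -
  have "C 1 v = (LINT p|\<mu>. indicator {..1} (fst p) * indicator {..v} (snd p))"
    using assms by (simp add: copula_eq_partial_mean_fst partial_mean_def)
  also have "\<dots> = (LINT p|\<mu>. indicator {..v} (snd p))"
  proof (rule integral_cong_AE)
    have "AE p in \<mu>. fst p \<le> 1" by (subst first.AE_U) auto
    then show "AE p in \<mu>. indicator {..1} (fst p) * indicator {..v} (snd p) = (indicator {..v} (snd p) :: real)"
      by eventually_elim auto
  qed measurable
  also have "\<dots> = (LINT s|lborel. indicator {0..1} s * indicator {..v} s)"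
    by (rule second.integral_U) measurable
  also have "\<dots> = (LINT s|lborel. indicator {0..v} s)"
    using assms by (intro Bochner_Integration.integral_cong) (auto simp: indicator_def)
  also have "\<dots> = v" using assms by simp
  finally show ?thesis .
qed

lemma concave_mean_copula_iff:
  assumes "v \<in> {0..1}"
  shows "first.concave_mean \<sigma> (\<lambda>p. indicator {..v} (snd p)) \<longleftrightarrow> concave_on {0..1} (\<lambda>u. \<sigma> * C u v)"
proof -
  have "integrable \<mu> (\<lambda>p. indicator {..v} (snd p) :: real)"
    by (rule integrable_const_bound[of _ 1]) (auto simp: indicator_def)
  moreover have "concave_on {0..1} (\<lambda>u. \<sigma> * C u v)
      \<longleftrightarrow> concave_on {0..1} (\<lambda>u. \<sigma> * partial_mean \<mu> fst (\<lambda>p. indicator {..v} (snd p)) u)"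
    by (rule concave_on_unit_cong) (use copula_eq_partial_mean_fst assms in auto)
  ultimately show ?thesis by (simp add: first.concave_mean_def)
qed

lemma AE_snd_neq: "AE p in \<mu>. snd p \<noteq> y"
  by (subst second.AE_U, measurable) (use AE_lborel_singleton[of y] in \<open>auto elim: eventually_mono\<close>)

text \<open>Outside the open unit interval the event \<open>V \<le> y\<close> is almost surely impossible or almost surely
certain.\<close>

lemma concave_mean_trivial_level:
  assumes "y \<notin> {0<..<1}"
  shows "first.concave_mean \<sigma> (\<lambda>p. indicator {..y} (snd p))"
proof -
  have "AE p in \<mu>. (if y \<le> 0 then 0 else 1) = (indicator {..y} (snd p) :: real)"
  proof -
    have "AE p in \<mu>. snd p \<in> {0..1}" by (subst second.AE_U) auto
    then show ?thesis
      using AE_snd_neq[of 0] by eventually_elim (use assms in \<open>auto simp: indicator_def\<close>)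
  qed
  then show ?thesis
    by (rule first.concave_mean_cong_AE[OF first.concave_mean_const, rotated]) auto
qed

lemma concave_mean_antimono_copula:
  fixes g :: "real \<Rightarrow> real"
  assumes C: "\<And>v. v \<in> {0..1} \<Longrightarrow> concave_on {0..1} (\<lambda>u. \<sigma> * C u v)"
    and g: "antimono g" "integrable \<mu> (\<lambda>p. g (snd p))"
  shows "first.concave_mean \<sigma> (\<lambda>p. g (snd p))"
proof (rule first.concave_mean_antimono[OF _ AE_snd_neq _ g])
  show "first.concave_mean \<sigma> (\<lambda>p. indicator {..y} (snd p))" for y
  proof (cases "y \<in> {0<..<1}")
    case True
    then show ?thesis using C[of y] concave_mean_copula_iff[of y] by simp
  qed (rule concave_mean_trivial_level)
qed measurable

text \<open>For fixed \<open>s\<close>, \<open>C(s, \<cdot>)\<close> is a primitive of the conditional probability \<open>k(v)\<close> of \<open>U \<le> s\<close>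
given \<open>V = v\<close>, so its derivative is \<open>k\<close> almost everywhere; integrating \<open>k\<close> against \<open>g\<close> gives
\<open>E[1{U \<le> s} g(V)]\<close> by the tower property.\<close>

lemma integral_partial2:
  fixes f g :: "real \<Rightarrow> real"
  assumes s: "s \<in> {0..1}" and [measurable]: "g \<in> borel_measurable borel" and B: "\<And>v. \<bar>g v\<bar> \<le> B"
    and fg: "AE v in lborel. v \<in> {0<..<1} \<longrightarrow> f v = g v"
  shows "integral\<^sup>L (lebesgue_on {0..1}) (\<lambda>v. partial2 C s v * f v)
    = partial_mean \<mu> fst (\<lambda>p. g (snd p)) s"
proof -
  let ?Z = "\<lambda>p :: real \<times> real. indicator {..s} (fst p) :: real"
  obtain k where k: "is_cond_exp_given \<mu> ?Z snd k" using is_cond_exp_given_exists by blast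
  then have [measurable]: "k \<in> borel_measurable borel" by (simp add: is_cond_exp_given_def)
  have Z: "integrable \<mu> ?Z" by (rule integrable_const_bound[of _ 1]) (auto simp: indicator_def)
  have "AE v in lborel. v \<in> {0<..<1} \<longrightarrow> (partial_mean \<mu> snd ?Z has_real_derivative k v) (at v)"
    by (rule AE_primitive_has_derivative[OF second.primitive_partial_mean_cond_exp[OF Z k]])
  then have "AE v in lborel. v \<in> {0<..<1} \<longrightarrow> partial2 C s v * f v = k v * g v"
    using fg
  proof eventually_elim
    case (elim v)
    have "partial2 C s v = deriv (partial_mean \<mu> snd ?Z) v" if "v \<in> {0<..<1}"
      unfolding partial2_def
      by (rule deriv_unit_cong) (use that s copula_eq_partial_mean_snd in auto)
    then show ?case using elim DERIV_imp_deriv by metis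
  qed
  then have "integral\<^sup>L (lebesgue_on {0..1}) (\<lambda>v. partial2 C s v * f v)
      = (LINT v|lborel. indicator {0..1} v * (k v * g v))"
    by (intro integral_unit_cong) auto
  also have "\<dots> = (LINT p|\<mu>. k (snd p) * g (snd p))"
    by (rule second.integral_U[symmetric]) measurable
  also have "\<dots> = (LINT p|\<mu>. g (snd p) * k (snd p))" by (simp add: mult.commute)
  also have "\<dots> = (LINT p|\<mu>. g (snd p) * ?Z p)"
  proof (rule is_cond_exp_given_intg(2)[OF prob_space_axioms _ _ _ k])
    show "integrable \<mu> (\<lambda>p. g (snd p) * ?Z p)"
      by (rule integrable_const_bound[of _ "\<bar>B\<bar>"])
        (use B in \<open>auto simp: indicator_def intro!: AE_I2 order_trans[OF _ abs_ge_self]\<close>)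
  qed measurable
  also have "\<dots> = partial_mean \<mu> fst (\<lambda>p. g (snd p)) s"
    by (simp add: partial_mean_def mult.commute)
  finally show ?thesis .
qed

lemma markov_operator_eq_deriv:
  fixes f g :: "real \<Rightarrow> real"
  assumes "u \<in> {0<..<1}" "g \<in> borel_measurable borel" "\<And>v. \<bar>g v\<bar> \<le> B"
    and "AE v in lborel. v \<in> {0<..<1} \<longrightarrow> f v = g v"
  shows "markov_operator C f u = deriv (partial_mean \<mu> fst (\<lambda>p. g (snd p))) u"
  unfolding markov_operator_def
  by (rule deriv_unit_cong[OF integral_partial2 assms(1)]) (use assms in auto)

lemma markov_operator_monotone_iff:
  fixes f g :: "real \<Rightarrow> real"
  assumes [measurable]: "g \<in> borel_measurable borel" and B: "\<And>v. \<bar>g v\<bar> \<le> B"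
    and fg: "AE v in lborel. v \<in> {0<..<1} \<longrightarrow> f v = g v"
  shows "ae_decreasing (markov_operator C f) \<longleftrightarrow> first.concave_mean 1 (\<lambda>p. g (snd p))"
    and "ae_increasing (markov_operator C f) \<longleftrightarrow> first.concave_mean (-1) (\<lambda>p. g (snd p))"
proof -
  let ?P = "partial_mean \<mu> fst (\<lambda>p. g (snd p))"
  have "AE u in lborel. u \<in> {0<..<1} \<longrightarrow> markov_operator C f u = deriv ?P u"
    using markov_operator_eq_deriv[OF _ assms] by auto
  note cong = ae_decreasing_cong[OF this]
  have Z: "(\<lambda>p. g (snd p)) \<in> borel_measurable \<mu>" by measurable
  have "AE p in \<mu>. \<bar>g (snd p)\<bar> \<le> B" using B by auto
  note iff = first.partial_mean_bounded_deriv_iff[OF Z this]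
  have int: "integrable \<mu> (\<lambda>p. g (snd p))"
    by (rule integrable_const_bound[of _ B]) (use B in auto)
  show "ae_decreasing (markov_operator C f) \<longleftrightarrow> first.concave_mean 1 (\<lambda>p. g (snd p))"
    using int by (simp add: cong iff first.concave_mean_def)
  show "ae_increasing (markov_operator C f) \<longleftrightarrow> first.concave_mean (-1) (\<lambda>p. g (snd p))"
    using int by (simp add: cong iff first.concave_mean_def concave_on_def)
qed

lemma partial1_monotone_iff:
  assumes v: "v \<in> {0..1}"
  shows "ae_decreasing (\<lambda>u. partial1 C u v) \<longleftrightarrow> concave_on {0..1} (\<lambda>u. C u v)"
    and "ae_increasing (\<lambda>u. partial1 C u v) \<longleftrightarrow> convex_on {0..1} (\<lambda>u. C u v)"
proof -
  let ?Z = "\<lambda>p :: real \<times> real. indicator {..v} (snd p) :: real"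
  let ?P = "partial_mean \<mu> fst ?Z"
  have "AE u in lborel. u \<in> {0<..<1} \<longrightarrow> partial1 C u v = deriv ?P u"
    unfolding partial1_def
    by (intro AE_I2 impI deriv_unit_cong) (use v copula_eq_partial_mean_fst in auto)
  note cong = ae_decreasing_cong[OF this]
  have Z: "?Z \<in> borel_measurable \<mu>" by measurable
  have "AE p in \<mu>. \<bar>?Z p\<bar> \<le> 1" by (auto simp: indicator_def)
  note iff = first.partial_mean_bounded_deriv_iff[OF Z this]
  have int: "integrable \<mu> ?Z" by (rule integrable_const_bound[of _ 1]) (auto simp: indicator_def)
  show "ae_decreasing (\<lambda>u. partial1 C u v) \<longleftrightarrow> concave_on {0..1} (\<lambda>u. C u v)"
    using concave_mean_copula_iff[OF v, of 1] int by (simp add: cong iff first.concave_mean_def)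
  show "ae_increasing (\<lambda>u. partial1 C u v) \<longleftrightarrow> convex_on {0..1} (\<lambda>u. C u v)"
    using concave_mean_copula_iff[OF v, of "-1"] int
    by (simp add: cong iff first.concave_mean_def concave_on_def)
qed

text \<open>A representative on the closed unit interval is bounded by its values at the end points, and is
extended to the line by constants.\<close>

lemma bounded_antimono_representative:
  assumes "ae_decreasing f"
  obtains g B where "antimono g" "\<And>v. \<bar>g v\<bar> \<le> (B :: real)"
    "AE v in lborel. v \<in> {0<..<1} \<longrightarrow> f v = g v"
proof -
  obtain g0 where g0: "antimono_on {0..1} g0" "AE v in lborel. v \<in> {0<..<1} \<longrightarrow> f v = g0 v"
    using assms by (auto simp: ae_decreasing_def AE_unit_iff)
  define c where "c v = max 0 (min 1 v)" for v :: real
  have c: "c v \<in> {0..1}" "v \<le> w \<Longrightarrow> c v \<le> c w" for v w by (auto simp: c_def)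
  have anti: "s \<le> t \<Longrightarrow> s \<in> {0..1} \<Longrightarrow> t \<in> {0..1} \<Longrightarrow> g0 t \<le> g0 s" for s t
    using g0(1) by (auto simp: monotone_on_def)
  show ?thesis
  proof
    show "antimono (\<lambda>v. g0 (c v))" by (intro antimonoI anti c)
    show "\<bar>g0 (c v)\<bar> \<le> max \<bar>g0 0\<bar> \<bar>g0 1\<bar>" for v
      using anti[of 0 "c v"] anti[of "c v" 1] c(1)[of v] by auto
    show "AE v in lborel. v \<in> {0<..<1} \<longrightarrow> f v = g0 (c v)"
      using g0(2) by eventually_elim (auto simp: c_def)
  qed
qed

text \<open>One direction tests the operator on \<open>1{\<cdot> \<le> v}\<close>, whose image is the derivative of \<open>C(\<cdot>, v)\<close>;
the other is the passage from indicators to decreasing functions.\<close>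

lemma markov_monotonicity_iff:
  shows "markov_monotonicity_preserving C \<longleftrightarrow> (\<forall>v\<in>{0..1}. concave_on {0..1} (\<lambda>u. C u v))"
    and "markov_monotonicity_reversing C \<longleftrightarrow> (\<forall>v\<in>{0..1}. convex_on {0..1} (\<lambda>u. C u v))"
proof -
  have main: "(\<forall>f. integrable (lebesgue_on {0..1}) f \<and> ae_decreasing f \<longrightarrow> T f)
      \<longleftrightarrow> (\<forall>v\<in>{0..1}. concave_on {0..1} (\<lambda>u. \<sigma> * C u v))"
    if T: "\<And>f g B. g \<in> borel_measurable borel \<Longrightarrow> (\<And>v. \<bar>g v\<bar> \<le> B) \<Longrightarrow>
        (AE v in lborel. v \<in> {0<..<1} \<longrightarrow> f v = g v) \<Longrightarrow> T f \<longleftrightarrow> first.concave_mean \<sigma> (\<lambda>p. g (snd p))"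
    for T :: "(real \<Rightarrow> real) \<Rightarrow> bool" and \<sigma>
  proof (intro iffI ballI allI impI)
    fix v :: real assume pres: "\<forall>f. integrable (lebesgue_on {0..1}) f \<and> ae_decreasing f \<longrightarrow> T f" and v: "v \<in> {0..1}"
    let ?f = "indicator {..v} :: real \<Rightarrow> real"
    have "integrable (lebesgue_on {0..1}) ?f"
    proof (rule integrableI_bounded_set[of "{0..1}" _ _ 1])
      show "?f \<in> borel_measurable (lebesgue_on {0..1})"
        by (intro measurable_restrict_space1 measurable_completion) measurable
    qed (auto simp: emeasure_restrict_space indicator_def)
    moreover have "ae_decreasing ?f"
      unfolding ae_decreasing_def
      by (intro exI[of _ ?f]) (auto simp: monotone_on_def indicator_def)
    ultimately have "T ?f" using pres by blast
    moreover have "T ?f \<longleftrightarrow> first.concave_mean \<sigma> (\<lambda>p. ?f (snd p))"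
      by (rule T[of ?f 1 ?f]) (auto simp: indicator_def)
    ultimately show "concave_on {0..1} (\<lambda>u. \<sigma> * C u v)" using concave_mean_copula_iff[OF v] by blast
  next
    fix f assume conc: "\<forall>v\<in>{0..1}. concave_on {0..1} (\<lambda>u. \<sigma> * C u v)"
      and "integrable (lebesgue_on {0..1}) f \<and> ae_decreasing f"
    then obtain g B where g: "antimono g" "\<And>v. \<bar>g v\<bar> \<le> B"
      "AE v in lborel. v \<in> {0<..<1} \<longrightarrow> f v = g v"
      using bounded_antimono_representative by metis
    have [measurable]: "g \<in> borel_measurable borel"
      using borel_measurable_mono[of "\<lambda>x. - g x"] g(1) by (auto simp: monotone_def)
    have "integrable \<mu> (\<lambda>p. g (snd p))"
      by (rule integrable_const_bound[of _ B]) (use g(2) in auto)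
    then have "first.concave_mean \<sigma> (\<lambda>p. g (snd p))"
      using conc g(1) by (intro concave_mean_antimono_copula) auto
    then show "T f" using T[of g B f] g by simp
  qed
  show "markov_monotonicity_preserving C \<longleftrightarrow> (\<forall>v\<in>{0..1}. concave_on {0..1} (\<lambda>u. C u v))"
    unfolding markov_monotonicity_preserving_def
    by (subst main[of _ 1, OF markov_operator_monotone_iff(1)]) auto
  show "markov_monotonicity_reversing C \<longleftrightarrow> (\<forall>v\<in>{0..1}. convex_on {0..1} (\<lambda>u. C u v))"
    unfolding markov_monotonicity_reversing_def
    by (subst main[of _ "-1", OF markov_operator_monotone_iff(2)]) (auto simp: concave_on_def)
qed

end

section \<open>Equivalence of the five conditions\<close>

text \<open>The defining relation of the copula only reaches points of the form \<open>(F(x), G(y))\<close>. Every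
interior \<open>u\<close> is \<open>F(q u)\<close>, and the event \<open>F(X) \<le> u\<close> agrees with \<open>X \<le> q u\<close> almost surely; at
the end points \<open>F\<close> need not attain the value, and the boundary values of a copula are used
instead.\<close>

lemma copula_of_eq_partial_mean:
  fixes X Y :: "'a \<Rightarrow> real"
  assumes M: "prob_space M" and X[measurable]: "X \<in> borel_measurable M"
    and Y[measurable]: "Y \<in> borel_measurable M"
    and cont: "continuous_on UNIV (cdf (distr M borel X))"
    and C: "is_copula_of C M X Y" and "copula_law \<mu> C" and u: "u \<in> {0..1}"
  shows "C u (cdf (distr M borel Y) y)
    = partial_mean M (\<lambda>\<omega>. cdf (distr M borel X) (X \<omega>)) (\<lambda>\<omega>. indicator {..y} (Y \<omega>)) u"
proof -
  interpret prob_space M by (rule M)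
  interpret cop: copula_law \<mu> C by fact
  interpret L: real_distribution "distr M borel X" by (rule real_distribution_distr[OF X])
  interpret LY: real_distribution "distr M borel Y" by (intro real_distribution_distr) simp
  let ?F = "cdf (distr M borel X)" and ?G = "cdf (distr M borel Y)"
  have [measurable]: "?F \<in> borel_measurable borel"
    by (intro borel_measurable_mono monoI L.cdf_nondecreasing)
  obtain q where q: "q \<in> borel_measurable borel" "mono_on {0<..<1} q"
      "\<And>s. s \<in> {0<..<1} \<Longrightarrow> ?F (q s) = s"
      "distr (restrict_space lborel {0<..<1}) borel q = distr M borel X"
    using quantile_function_exists[OF L.real_distribution_axioms cont] by metis
  have aeq: "AE \<omega> in M. X \<omega> = q (?F (X \<omega>)) \<and> ?F (X \<omega>) \<in> {0<..<1}"
    by (rule AE_quantile_cdf[OF M X cont]) (use q in auto)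
  then have range: "AE \<omega> in M. ?F (X \<omega>) \<in> {0<..<1}" by eventually_elim simp
  have G: "?G y \<in> {0..1}" using LY.cdf_nonneg LY.cdf_bounded_prob by auto
  have Gprob: "?G y = measure M {\<omega> \<in> space M. Y \<omega> \<le> y}"
    unfolding cdf_def by (subst measure_distr) (auto intro!: arg_cong[where f="measure M"])
  let ?P = "partial_mean M (\<lambda>\<omega>. ?F (X \<omega>)) (\<lambda>\<omega>. indicator {..y} (Y \<omega>)) u"
  have P: "?P = measure M {\<omega> \<in> space M. Q \<omega> \<and> Y \<omega> \<le> y}"
    if Q[measurable]: "Measurable.pred M Q" and ae: "AE \<omega> in M. ?F (X \<omega>) \<le> u \<longleftrightarrow> Q \<omega>" for Q
  proof -
    have "?P = (LINT \<omega>|M. indicator {\<omega> \<in> space M. Q \<omega> \<and> Y \<omega> \<le> y} \<omega>)"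
      unfolding partial_mean_def
    proof (rule integral_cong_AE)
      show "AE \<omega> in M. indicator {..u} (?F (X \<omega>)) * indicator {..y} (Y \<omega>)
          = (indicator {\<omega> \<in> space M. Q \<omega> \<and> Y \<omega> \<le> y} \<omega> :: real)"
        using ae AE_space by eventually_elim (auto simp: indicator_def)
    qed measurable
    then show ?thesis by simp
  qed
  consider "u = 0" | "u = 1" | "u \<in> {0<..<1}" using u by fastforce
  then show ?thesis
  proof cases
    case 1
    have "?P = measure M {\<omega> \<in> space M. False \<and> Y \<omega> \<le> y}"
      by (rule P, measurable) (use range in eventually_elim, use 1 in auto)
    then show ?thesis using cop.copula_zero_left[OF G] 1 by simp
  next
    case 2
    have "?P = measure M {\<omega> \<in> space M. True \<and> Y \<omega> \<le> y}"
      by (rule P, measurable) (use range in eventually_elim, use 2 in auto)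
    then show ?thesis using cop.copula_one_left[OF G] 2 by (simp add: Gprob)
  next
    case 3
    have "?P = measure M {\<omega> \<in> space M. X \<omega> \<le> q u \<and> Y \<omega> \<le> y}"
    proof (rule P)
      show "AE \<omega> in M. ?F (X \<omega>) \<le> u \<longleftrightarrow> X \<omega> \<le> q u"
        using aeq
      proof eventually_elim
        case (elim \<omega>)
        show ?case
        proof
          assume "?F (X \<omega>) \<le> u"
          then show "X \<omega> \<le> q u" using elim q(2) 3 by (metis monotone_onD)
        next
          assume "X \<omega> \<le> q u"
          then show "?F (X \<omega>) \<le> u" using L.cdf_nondecreasing q(3)[OF 3] by metis
        qed
      qed
    qed measurable
    also have "\<dots> = C (?F (q u)) (?G y)" using C by (simp add: is_copula_of_def)
    finally show ?thesis using q(3)[OF 3] by simp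
  qed
qed

lemma ball_unit_iff_cdf:
  assumes L: "real_distribution L" and cont: "continuous_on UNIV (cdf L)"
    and P01: "P 0" "P 1"
  shows "(\<forall>v\<in>{0..1}. P v) \<longleftrightarrow> (\<forall>y. P (cdf L y))"
proof -
  interpret real_distribution L by fact
  obtain q where "\<And>s. s \<in> {0<..<1} \<Longrightarrow> cdf L (q s) = s"
    using quantile_function_exists[OF assms(1,2)] by metis
  then have "\<exists>y. v = cdf L y" if "v \<in> {0<..<1}" for v using that by metis
  moreover have "v = 0 \<or> v = 1 \<or> v \<in> {0<..<1}" if "v \<in> {0..1}" for v :: real using that by auto
  moreover have "cdf L y \<in> {0..1}" for y using cdf_nonneg cdf_bounded_prob by auto
  ultimately show ?thesis using P01 by metis
qed

theorem theorem3p9: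
  fixes M :: "'a measure" and X Y :: "'a \<Rightarrow> real" and C :: "real \<Rightarrow> real \<Rightarrow> real"
  assumes "prob_space M"
    and "X \<in> borel_measurable M" and "Y \<in> borel_measurable M"
    and "continuous_on UNIV (cdf (distr M borel X))"
    and "continuous_on UNIV (cdf (distr M borel Y))"
    and "is_copula_of C M X Y"
  shows
    "((stoch_increasing M Y X \<longleftrightarrow> copula_stoch_increasing1 C) \<and>
      (copula_stoch_increasing1 C \<longleftrightarrow> (\<forall>v\<in>{0..1}. concave_on {0..1} (\<lambda>u. C u v))) \<and>
      ((\<forall>v\<in>{0..1}. concave_on {0..1} (\<lambda>u. C u v)) \<longleftrightarrow> markov_monotonicity_preserving C) \<and>
      (markov_monotonicity_preserving C \<longleftrightarrow>
        (\<forall>f :: real \<Rightarrow> real. antimono f \<and> integrable M (\<lambda>\<omega>. f (Y \<omega>)) \<longrightarrow>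
           law_decreasing (distr M borel X) (cond_exp_given M (\<lambda>\<omega>. f (Y \<omega>)) X)))) \<and>
     ((stoch_decreasing M Y X \<longleftrightarrow> copula_stoch_decreasing1 C) \<and>
      (copula_stoch_decreasing1 C \<longleftrightarrow> (\<forall>v\<in>{0..1}. convex_on {0..1} (\<lambda>u. C u v))) \<and>
      ((\<forall>v\<in>{0..1}. convex_on {0..1} (\<lambda>u. C u v)) \<longleftrightarrow> markov_monotonicity_reversing C) \<and>
      (markov_monotonicity_reversing C \<longleftrightarrow>
        (\<forall>f :: real \<Rightarrow> real. antimono f \<and> integrable M (\<lambda>\<omega>. f (Y \<omega>)) \<longrightarrow>
           law_increasing (distr M borel X) (cond_exp_given M (\<lambda>\<omega>. f (Y \<omega>)) X))))"
proof -
  note M = assms(1) and X[measurable] = assms(2) and Y[measurable] = assms(3)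
    and contX = assms(4) and contY = assms(5) and C = assms(6)
  let ?L = "distr M borel X" and ?G = "cdf (distr M borel Y)"
  let ?U = "\<lambda>\<omega>. cdf ?L (X \<omega>)"
  interpret prob_space M by (rule M)
  interpret U: uniform_variable M ?U by (rule uniform_variable_cdf[OF M X contX])
  interpret LY: real_distribution "distr M borel Y" by (rule real_distribution_distr[OF Y])
  obtain \<mu> where "copula_law \<mu> C"
    using C unfolding is_copula_of_def is_copula_def copula_law_def copula_law_axioms_def by blast
  then interpret cop: copula_law \<mu> C .
  let ?Z = "\<lambda>y \<omega>. indicator {..y} (Y \<omega>) :: real"
  have intZ: "integrable M (?Z y)" for y
    by (rule integrable_const_bound[of _ 1]) (auto simp: indicator_def)
  have noatom: "AE \<omega> in M. Y \<omega> \<noteq> y" for y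
  proof -
    interpret V: uniform_variable M "\<lambda>\<omega>. ?G (Y \<omega>)" by (rule uniform_variable_cdf[OF M Y contY])
    have "AE \<omega> in M. ?G (Y \<omega>) \<noteq> ?G y"
      by (subst V.AE_U, measurable) (use AE_lborel_singleton[of "?G y"] in \<open>auto elim: eventually_mono\<close>)
    then show ?thesis by eventually_elim auto
  qed
  \<comment> \<open>The levels 0 and 1 need not be values of the distribution function of \<open>Y\<close>, so they are treated apart.\<close>
  have linear: "concave_on {0..1} (\<lambda>u. \<sigma> * C u 0)" "concave_on {0..1} (\<lambda>u. \<sigma> * C u 1)" for \<sigma>
    by (rule cop.concave_mean_copula_iff[THEN iffD1, OF _ cop.concave_mean_trivial_level]; simp)+
  have copula_family_iff: "(\<forall>v\<in>{0..1}. concave_on {0..1} (\<lambda>u. \<sigma> * C u v)) \<longleftrightarrow> (\<forall>y. U.concave_mean \<sigma> (?Z y))" for \<sigma>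
  proof -
    have "concave_on {0..1} (\<lambda>u. \<sigma> * C u (?G y)) \<longleftrightarrow> U.concave_mean \<sigma> (?Z y)" for y
      unfolding U.concave_mean_def using intZ
      by (subst concave_on_unit_cong[of _ "\<lambda>u. \<sigma> * partial_mean M ?U (?Z y) u"])
        (auto simp: copula_of_eq_partial_mean[OF M X Y contX C \<open>copula_law \<mu> C\<close>])
    then show ?thesis
      by (subst ball_unit_iff_cdf[OF LY.real_distribution_axioms contY]) (use linear in auto)
  qed
  have law: "integrable M Z \<Longrightarrow> law_decreasing ?L (cond_exp_given M Z X) \<longleftrightarrow> U.concave_mean 1 Z"
    "integrable M Z \<Longrightarrow> law_increasing ?L (cond_exp_given M Z X) \<longleftrightarrow> U.concave_mean (-1) Z" for Z
    by (auto simp: U.concave_mean_def law_monotone_cond_exp_iff[OF M X contX] concave_on_def)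
  \<comment> \<open>The two indicators differ only outside the space of \<open>M\<close>.\<close>
  have event_eq: "U.concave_mean \<sigma> (indicator {\<omega> \<in> space M. Y \<omega> \<le> y}) \<longleftrightarrow> U.concave_mean \<sigma> (?Z y)" for \<sigma> y
    by (rule iffI; erule U.concave_mean_cong_AE) (auto simp: indicator_def)
  have "integrable M (indicator {\<omega> \<in> space M. Y \<omega> \<le> y} :: 'a \<Rightarrow> real)" for y
    by (rule integrable_const_bound[of _ 1]) (auto simp: indicator_def)
  note law_event = law[OF this, unfolded event_eq]
  have stoch: "stoch_increasing M Y X \<longleftrightarrow> (\<forall>y. U.concave_mean 1 (?Z y))"
    "stoch_decreasing M Y X \<longleftrightarrow> (\<forall>y. U.concave_mean (-1) (?Z y))"
    by (simp_all add: stoch_increasing_def stoch_decreasing_def cond_prob_le_def law_event)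
  have expect: "(\<forall>f :: real \<Rightarrow> real. antimono f \<and> integrable M (\<lambda>\<omega>. f (Y \<omega>)) \<longrightarrow> U.concave_mean \<sigma> (\<lambda>\<omega>. f (Y \<omega>)))
      \<longleftrightarrow> (\<forall>y. U.concave_mean \<sigma> (?Z y))" for \<sigma>
  proof (intro iffI allI impI)
    fix y assume *: "\<forall>f :: real \<Rightarrow> real. antimono f \<and> integrable M (\<lambda>\<omega>. f (Y \<omega>)) \<longrightarrow> U.concave_mean \<sigma> (\<lambda>\<omega>. f (Y \<omega>))"
    have "antimono (indicator {..y} :: real \<Rightarrow> real)" by (intro antimonoI) (auto simp: indicator_def)
    then show "U.concave_mean \<sigma> (?Z y)" using * intZ by blast
  next
    fix f :: "real \<Rightarrow> real" assume "\<forall>y. U.concave_mean \<sigma> (?Z y)" "antimono f \<and> integrable M (\<lambda>\<omega>. f (Y \<omega>))"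
    then show "U.concave_mean \<sigma> (\<lambda>\<omega>. f (Y \<omega>))"
      using U.concave_mean_antimono[OF Y noatom, of \<sigma> f] by blast
  qed
  have law_expect: "(\<forall>f :: real \<Rightarrow> real. antimono f \<and> integrable M (\<lambda>\<omega>. f (Y \<omega>)) \<longrightarrow>
           law_decreasing ?L (cond_exp_given M (\<lambda>\<omega>. f (Y \<omega>)) X)) \<longleftrightarrow> (\<forall>y. U.concave_mean 1 (?Z y))"
    "(\<forall>f :: real \<Rightarrow> real. antimono f \<and> integrable M (\<lambda>\<omega>. f (Y \<omega>)) \<longrightarrow>
           law_increasing ?L (cond_exp_given M (\<lambda>\<omega>. f (Y \<omega>)) X)) \<longleftrightarrow> (\<forall>y. U.concave_mean (-1) (?Z y))"
    unfolding expect[symmetric] using law by blast+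
  have partial: "copula_stoch_increasing1 C \<longleftrightarrow> (\<forall>v\<in>{0..1}. concave_on {0..1} (\<lambda>u. C u v))"
    "copula_stoch_decreasing1 C \<longleftrightarrow> (\<forall>v\<in>{0..1}. convex_on {0..1} (\<lambda>u. C u v))"
    by (simp_all add: copula_stoch_increasing1_def copula_stoch_decreasing1_def cop.partial1_monotone_iff)
  have copula_iff: "(\<forall>v\<in>{0..1}. concave_on {0..1} (\<lambda>u. C u v)) \<longleftrightarrow> (\<forall>y. U.concave_mean 1 (?Z y))"
    "(\<forall>v\<in>{0..1}. convex_on {0..1} (\<lambda>u. C u v)) \<longleftrightarrow> (\<forall>y. U.concave_mean (-1) (?Z y))"
    using copula_family_iff[of 1] copula_family_iff[of "-1"] by (simp_all add: concave_on_def)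
  show ?thesis
    by (simp only: stoch law_expect partial cop.markov_monotonicity_iff copula_iff simp_thms)
qed

end
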